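(* Let $(M^{4n},Q,\omega)$, $n>1$, be an almost quaternionic skew-Hermitian manifold, let $H=\{J_1,J_2,J_3\}$ be a (local) admissible basis of $Q$, and let $(a,b,c)$ be a cyclic permutation of $(1,2,3)$. Then the local almost complex structure $J_a$ is integrable if and only if the following two conditions hold for all vector fields $X,Y\in\Gamma(TM)$: $$\pi_{J_a}(T^{Q,\omega})(X,Y)=0,$$ $$\psi_a(X)J_bY+\psi_a(J_aX)J_cY-\psi_a(Y)J_bX-\psi_a(J_aY)J_cX=0,$$ where $\psi_a$ is the local 1-form $\psi_a:=\gamma_c\circ J_a-\gamma_b$.
   Context: An almost quaternionic structure on $M^{4n}$ ($n>1$) is a rank-3 subbundle $Q\subset\mathrm{End}(TM)$ locally spanned by an admissible basis $J_1,J_2,J_3$, i.e. $J_a^2=-\mathrm{Id}$, $J_1J_2=J_3=-J_2J_1$. An almost quaternionic skew-Hermitian (qs-H) manifold $(M^{4n},Q,\omega)$ is such a manifold with a non-degenerate 2-form $\omega$ satisfying $\omega(J_aX,J_aY)=\omega(X,Y)$ for every admissible basis. Adapted connection. $N_J(X,Y)=[JX,JY]-J[JX,Y]-J[X,JY]-[X,Y]$. The Obata connection $\nabla^H$ of $H=\{J_a\}$ is the unique connection with $\nabla^HJ_a=0$ ($a=1,2,3$) and torsion $T^H=\frac16\sum_aN_{J_a}$. With $\mathrm{vol}=\omega^{2n}$, the unimodular Oproiu connection $\nabla^{Q,\mathrm{vol}}$ is the unique connection preserving $Q$ and $\mathrm{vol}$ whose torsion is, for any admissible basis, $T^Q=T^H+\sum_a\partial(\tau_a\otimes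 J_a)$, where $\tau_a(X)=\frac1{4n-2}\mathrm{tr}(J_aT^H_X)$ and $\partial(\tau\otimes J)(X,Y)=\tau(X)JY-\tau(Y)JX$. Then $\nabla^{Q,\omega}=\nabla^{Q,\mathrm{vol}}+A$ with $\omega(A(X,Y),Z)=\frac12(\nabla^{Q,\mathrm{vol}}_X\omega)(Y,Z)$; it preserves $Q$ and $\omega$, and $T^{Q,\omega}$ is its torsion. The local 1-forms $\gamma_a$ are defined by $\nabla^{Q,\omega}_XJ_a=\gamma_c(X)J_b-\gamma_b(X)J_c$ for every cyclic permutation $(a,b,c)$ of $(1,2,3)$. For a $TM$-valued 2-form $\phi$: $\pi_{J_a}(\phi)(X,Y)=\frac14\big(\phi(X,Y)+J_a(\phi(J_aX,Y)+\phi(X,J_aY))-\phi(J_aX,J_aY)\big)$. *)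

theory Defs
  imports "HOL-Analysis.Analysis" "HOL-Combinatorics.Permutations"
begin

section \<open>Smooth maps and smooth manifolds\<close>

text \<open>To be used on open sets \<open>S\<close> only.\<close>

fun Ck_on :: "nat \<Rightarrow> 'a::real_normed_vector set \<Rightarrow> ('a \<Rightarrow> 'b::real_normed_vector) \<Rightarrow> bool" where
  "Ck_on 0 S f \<longleftrightarrow> continuous_on S f"
| "Ck_on (Suc k) S f \<longleftrightarrow> (\<forall>x\<in>S. f differentiable (at x)) \<and>
     (\<forall>v. Ck_on k S (\<lambda>x. frechet_derivative f (at x) v))"

definition smooth_on :: "'a::real_normed_vector set \<Rightarrow> ('a \<Rightarrow> 'b::real_normed_vector) \<Rightarrow> bool" where
  "smooth_on S f \<longleftrightarrow> (\<forall>k. Ck_on k S f)"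

text \<open>A chart is a pair of its domain and its coordinate map, whose values off the domain are
  irrelevant.\<close>

type_synonym ('m, 'e) chart = "'m set \<times> ('m \<Rightarrow> 'e)"
type_synonym ('m, 'e) atlas = "('m, 'e) chart set"

definition chart_inv :: "('m, 'e) chart \<Rightarrow> 'e \<Rightarrow> 'm" where
  "chart_inv c = inv_into (fst c) (snd c)"

definition is_chart :: "'m topology \<Rightarrow> ('m, 'e::euclidean_space) chart \<Rightarrow> bool" where
  "is_chart M c \<longleftrightarrow> openin M (fst c) \<and> open (snd c ` fst c) \<and>
     homeomorphic_map (subtopology M (fst c)) (top_of_set (snd c ` fst c)) (snd c)"

definition smooth_manifold :: "'m topology \<Rightarrow> ('m, 'e::euclidean_space) atlas \<Rightarrow> bool" where
  "smooth_manifold M \<A> \<longleftrightarrow> Hausdorff_space M \<and> second_countable M \<and>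
     (\<forall>c\<in>\<A>. is_chart M c) \<and> \<Union> (fst ` \<A>) = topspace M \<and>
     (\<forall>c\<in>\<A>. \<forall>d\<in>\<A>. smooth_on (snd c ` (fst c \<inter> fst d)) (snd d \<circ> chart_inv c))"

section \<open>Tangent vectors and vector fields\<close>

text \<open>
  The tangent space at \<open>p\<close> is identified with the model space \<open>'e\<close> by means of a chart
  \<open>chart_at \<A> p\<close> around \<open>p\<close>, chosen once and for all: \<open>u :: 'e\<close> stands for the tangent vector at
  \<open>p\<close> whose components in this chart are \<open>u\<close>. The chosen charts at different points need not be
  related, so vector fields must be transformed into one and the same chart before they are
  differentiated. The components in a chart \<open>c\<close> of a tangent vector at \<open>q\<close> are obtained by applying
  the derivative \<open>components_in \<A> c q\<close> of the change of charts.
\<close>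

definition chart_at :: "('m, 'e) atlas \<Rightarrow> 'm \<Rightarrow> ('m, 'e) chart" where
  "chart_at \<A> p = (SOME c. c \<in> \<A> \<and> p \<in> fst c)"

definition components_in ::
    "('m, 'e::euclidean_space) atlas \<Rightarrow> ('m, 'e) chart \<Rightarrow> 'm \<Rightarrow> 'e \<Rightarrow> 'e" where
  "components_in \<A> c q =
     frechet_derivative (snd c \<circ> chart_inv (chart_at \<A> q)) (at (snd (chart_at \<A> q) q))"

definition local_rep ::
    "('m, 'e::euclidean_space) atlas \<Rightarrow> ('m, 'e) chart \<Rightarrow> ('m \<Rightarrow> 'e) \<Rightarrow> 'e \<Rightarrow> 'e" where
  "local_rep \<A> c X y = components_in \<A> c (chart_inv c y) (X (chart_inv c y))"

text \<open>
  \<open>smooth_functions \<A> V\<close> and \<open>vector_fields \<A> V\<close> are the smooth functions and smooth vector fields on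
  an open set \<open>V\<close>. They are represented by total functions; the values off \<open>V\<close> are unconstrained,
  so that both sets grow when \<open>V\<close> shrinks.
\<close>

definition smooth_functions :: "('m, 'e::euclidean_space) atlas \<Rightarrow> 'm set \<Rightarrow> ('m \<Rightarrow> real) set" where
  "smooth_functions \<A> V = {f. \<forall>c\<in>\<A>. smooth_on (snd c ` (fst c \<inter> V)) (f \<circ> chart_inv c)}"

definition vector_fields :: "('m, 'e::euclidean_space) atlas \<Rightarrow> 'm set \<Rightarrow> ('m \<Rightarrow> 'e) set" where
  "vector_fields \<A> V = {X. \<forall>c\<in>\<A>. smooth_on (snd c ` (fst c \<inter> V)) (local_rep \<A> c X)}"

text \<open>\<open>dir_deriv \<A> X f p\<close> is \<open>(X f)(p)\<close>; \<open>lie_bracket\<close> is the usual coordinate formula, evaluated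
  at \<open>p\<close> in the chart that identifies the tangent space at \<open>p\<close> with \<open>'e\<close>.\<close>

definition dir_deriv ::
    "('m, 'e::euclidean_space) atlas \<Rightarrow> ('m \<Rightarrow> 'e) \<Rightarrow> ('m \<Rightarrow> real) \<Rightarrow> 'm \<Rightarrow> real" where
  "dir_deriv \<A> X f p =
     (let c = chart_at \<A> p in frechet_derivative (f \<circ> chart_inv c) (at (snd c p)) (X p))"

definition lie_bracket ::
    "('m, 'e::euclidean_space) atlas \<Rightarrow> ('m \<Rightarrow> 'e) \<Rightarrow> ('m \<Rightarrow> 'e) \<Rightarrow> 'm \<Rightarrow> 'e" where
  "lie_bracket \<A> X Y p =
     (let c = chart_at \<A> p in
        frechet_derivative (local_rep \<A> c Y) (at (snd c p)) (X p)
      - frechet_derivative (local_rep \<A> c X) (at (snd c p)) (Y p))"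

section \<open>Tensor fields\<close>

text \<open>Tensor fields are pointwise (multi)linear; they are smooth if they map smooth vector fields on
  open sets to smooth objects.\<close>

type_synonym ('m, 'e) endo_field = "'m \<Rightarrow> 'e \<Rightarrow>\<^sub>L 'e"

definition app_field ::
    "('m, 'e::euclidean_space) endo_field \<Rightarrow> ('m \<Rightarrow> 'e) \<Rightarrow> 'm \<Rightarrow> 'e" where
  "app_field S X = (\<lambda>p. blinfun_apply (S p) (X p))"

definition smooth_endo_field ::
    "'m topology \<Rightarrow> ('m, 'e::euclidean_space) atlas \<Rightarrow> 'm set \<Rightarrow> ('m, 'e) endo_field \<Rightarrow> bool" where
  "smooth_endo_field M \<A> V S \<longleftrightarrow>
     (\<forall>W X. openin M W \<and> W \<subseteq> V \<and> X \<in> vector_fields \<A> W \<longrightarrow> app_field S X \<in> vector_fields \<A> W)"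

definition one_form ::
    "'m topology \<Rightarrow> ('m, 'e::euclidean_space) atlas \<Rightarrow> 'm set \<Rightarrow> ('m \<Rightarrow> 'e \<Rightarrow> real) \<Rightarrow> bool" where
  "one_form M \<A> V \<gamma> \<longleftrightarrow> (\<forall>p\<in>V. linear (\<gamma> p)) \<and>
     (\<forall>W X. openin M W \<and> W \<subseteq> V \<and> X \<in> vector_fields \<A> W \<longrightarrow>
        (\<lambda>p. \<gamma> p (X p)) \<in> smooth_functions \<A> W)"

definition nondegenerate_two_form ::
    "'m topology \<Rightarrow> ('m, 'e::euclidean_space) atlas \<Rightarrow> ('m \<Rightarrow> 'e \<Rightarrow> 'e \<Rightarrow> real) \<Rightarrow> bool" where
  "nondegenerate_two_form M \<A> \<omega> \<longleftrightarrow>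
     (\<forall>p\<in>topspace M. bilinear (\<omega> p) \<and> (\<forall>u. \<omega> p u u = 0) \<and>
        (\<forall>u. u \<noteq> 0 \<longrightarrow> (\<exists>v. \<omega> p u v \<noteq> 0))) \<and>
     (\<forall>W X Y. openin M W \<and> X \<in> vector_fields \<A> W \<and> Y \<in> vector_fields \<A> W \<longrightarrow>
        (\<lambda>p. \<omega> p (X p) (Y p)) \<in> smooth_functions \<A> W)"

text \<open>\<open>wedge_power \<beta> k\<close> is the \<open>k\<close>-fold exterior power of the 2-form \<open>\<beta>\<close>, a \<open>2k\<close>-form with arguments
  \<open>v 0, \<dots>, v (2k - 1)\<close>, for the convention
  \<open>(\<alpha> \<and> \<beta>)(v) = 1/(r! s!) \<Sum>\<^sub>\<sigma> sgn \<sigma> \<alpha>(v\<^sub>\<sigma>) \<beta>(v\<^sub>\<sigma>)\<close> on forms of degrees \<open>r\<close> and \<open>s\<close>.\<close>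

definition wedge_power :: "('e \<Rightarrow> 'e \<Rightarrow> real) \<Rightarrow> nat \<Rightarrow> (nat \<Rightarrow> 'e) \<Rightarrow> real" where
  "wedge_power \<beta> k v =
     (\<Sum>\<sigma> | \<sigma> permutes {..<2*k}.
        of_int (sign \<sigma>) * (\<Prod>i<k. \<beta> (v (\<sigma> (2*i))) (v (\<sigma> (2*i+1))))) / 2 ^ k"

definition endo_trace :: "('e::euclidean_space \<Rightarrow> 'e) \<Rightarrow> real" where
  "endo_trace f = (\<Sum>b\<in>Basis. f b \<bullet> b)"

text \<open>Let \<open>\<Phi>\<close> be a tensorial operation on vector fields, that is, \<open>\<Phi> X Y p\<close> depends only on \<open>X p\<close> and
  \<open>Y p\<close>. Then \<open>tensor_at M \<A> \<Phi> p u v\<close> is its value on the tangent vectors \<open>u\<close>, \<open>v\<close> at \<open>p\<close>.\<close>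

type_synonym ('m, 'e) field_op = "('m \<Rightarrow> 'e) \<Rightarrow> ('m \<Rightarrow> 'e) \<Rightarrow> 'm \<Rightarrow> 'e"

definition tensor_at ::
    "'m topology \<Rightarrow> ('m, 'e::euclidean_space) atlas \<Rightarrow> ('m, 'e) field_op \<Rightarrow> 'm \<Rightarrow> 'e \<Rightarrow> 'e \<Rightarrow> 'e" where
  "tensor_at M \<A> \<Phi> p u v =
     (THE w. \<forall>V X Y. openin M V \<and> p \<in> V \<and> X \<in> vector_fields \<A> V \<and> Y \<in> vector_fields \<A> V \<and>
        X p = u \<and> Y p = v \<longrightarrow> \<Phi> X Y p = w)"

section \<open>Connections\<close>

text \<open>A connection acts on vector fields on arbitrary open sets, compatibly with restriction;
  \<open>D X Y\<close> is \<open>\<nabla>\<^sub>X Y\<close>.\<close>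

definition affine_connection ::
    "'m topology \<Rightarrow> ('m, 'e::euclidean_space) atlas \<Rightarrow> ('m, 'e) field_op \<Rightarrow> bool" where
  "affine_connection M \<A> D \<longleftrightarrow>
     (\<forall>V. openin M V \<longrightarrow>
       (\<forall>X\<in>vector_fields \<A> V. \<forall>X'\<in>vector_fields \<A> V.
        \<forall>Y\<in>vector_fields \<A> V. \<forall>Y'\<in>vector_fields \<A> V. \<forall>f\<in>smooth_functions \<A> V.
          D X Y \<in> vector_fields \<A> V \<and>
          ((\<forall>p\<in>V. X p = X' p \<and> Y p = Y' p) \<longrightarrow> (\<forall>p\<in>V. D X Y p = D X' Y' p)) \<and>
          (\<forall>p\<in>V.
             D (\<lambda>q. X q + X' q) Y p = D X Y p + D X' Y p \<and>
             D (\<lambda>q. f q *\<^sub>R X q) Y p = f p *\<^sub>R D X Y p \<and>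
             D X (\<lambda>q. Y q + Y' q) p = D X Y p + D X Y' p \<and>
             D X (\<lambda>q. f q *\<^sub>R Y q) p = dir_deriv \<A> X f p *\<^sub>R Y p + f p *\<^sub>R D X Y p)))"

definition torsion ::
    "('m, 'e::euclidean_space) atlas \<Rightarrow> ('m, 'e) field_op \<Rightarrow> ('m, 'e) field_op" where
  "torsion \<A> D X Y p = D X Y p - D Y X p - lie_bracket \<A> X Y p"

text \<open>\<open>(\<nabla>\<^sub>X S) Y\<close> for a field \<open>S\<close> of endomorphisms, and \<open>(\<nabla>\<^sub>X \<omega>)(Y, Z)\<close> for a 2-form \<open>\<omega>\<close>.\<close>

definition cov_endo ::
    "('m, 'e::euclidean_space) field_op \<Rightarrow> ('m \<Rightarrow> 'e) \<Rightarrow> ('m, 'e) endo_field \<Rightarrow> ('m \<Rightarrow> 'e) \<Rightarrow> 'm \<Rightarrow> 'e" where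
  "cov_endo D X S Y p = D X (app_field S Y) p - app_field S (D X Y) p"

definition cov_two_form ::
    "('m, 'e::euclidean_space) atlas \<Rightarrow> ('m, 'e) field_op \<Rightarrow> ('m \<Rightarrow> 'e) \<Rightarrow>
     ('m \<Rightarrow> 'e \<Rightarrow> 'e \<Rightarrow> real) \<Rightarrow> ('m \<Rightarrow> 'e) \<Rightarrow> ('m \<Rightarrow> 'e) \<Rightarrow> 'm \<Rightarrow> real" where
  "cov_two_form \<A> D X \<omega> Y Z p =
     dir_deriv \<A> X (\<lambda>q. \<omega> q (Y q) (Z q)) p - \<omega> p (D X Y p) (Z p) - \<omega> p (Y p) (D X Z p)"

definition preserves_form ::
    "'m topology \<Rightarrow> ('m, 'e::euclidean_space) atlas \<Rightarrow> ('m, 'e) field_op \<Rightarrow>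
     nat \<Rightarrow> ('m \<Rightarrow> (nat \<Rightarrow> 'e) \<Rightarrow> real) \<Rightarrow> bool" where
  "preserves_form M \<A> D k \<mu> \<longleftrightarrow>
     (\<forall>V X Z. openin M V \<and> X \<in> vector_fields \<A> V \<and> (\<forall>i<k. Z i \<in> vector_fields \<A> V) \<longrightarrow>
       (\<forall>p\<in>V. dir_deriv \<A> X (\<lambda>q. \<mu> q (\<lambda>i. Z i q)) p
               = (\<Sum>i<k. \<mu> p ((\<lambda>j. Z j p)(i := D X (Z i) p)))))"

text \<open>The covariant derivatives of local sections of the subbundle \<open>Q\<close> are sections of \<open>Q\<close>.\<close>

definition preserves_bundle ::
    "'m topology \<Rightarrow> ('m, 'e::euclidean_space) atlas \<Rightarrow> ('m, 'e) field_op \<Rightarrow>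
     ('m \<Rightarrow> ('e \<Rightarrow>\<^sub>L 'e) set) \<Rightarrow> bool" where
  "preserves_bundle M \<A> D Q \<longleftrightarrow>
     (\<forall>V X S. openin M V \<and> X \<in> vector_fields \<A> V \<and> smooth_endo_field M \<A> V S \<and> (\<forall>p\<in>V. S p \<in> Q p) \<longrightarrow>
       (\<exists>R. (\<forall>p\<in>V. R p \<in> Q p) \<and>
            (\<forall>Y\<in>vector_fields \<A> V. \<forall>p\<in>V. cov_endo D X S Y p = app_field R Y p)))"

section \<open>Almost quaternionic skew-Hermitian manifolds\<close>

text \<open>The bundle \<open>Q\<close> is given by its fibres. A local basis \<open>J 1, J 2, J 3\<close> is a family indexed by
  natural numbers, of which only the members with index in \<open>{1, 2, 3}\<close> matter; the quaternionic
  relations make it linearly independent, so that \<open>Q\<close> has rank 3.\<close>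

definition admissible_basis ::
    "'m topology \<Rightarrow> ('m, 'e::euclidean_space) atlas \<Rightarrow> ('m \<Rightarrow> ('e \<Rightarrow>\<^sub>L 'e) set) \<Rightarrow>
     'm set \<Rightarrow> (nat \<Rightarrow> ('m, 'e) endo_field) \<Rightarrow> bool" where
  "admissible_basis M \<A> Q U J \<longleftrightarrow> openin M U \<and>
     (\<forall>a\<in>{1,2,3}. smooth_endo_field M \<A> U (J a)) \<and>
     (\<forall>p\<in>U. (\<forall>a\<in>{1,2,3}. J a p o\<^sub>L J a p = - id_blinfun) \<and>
        J 1 p o\<^sub>L J 2 p = J 3 p \<and> J 2 p o\<^sub>L J 1 p = - J 3 p \<and>
        Q p = span {J 1 p, J 2 p, J 3 p})"

definition almost_quaternionic ::
    "'m topology \<Rightarrow> ('m, 'e::euclidean_space) atlas \<Rightarrow> ('m \<Rightarrow> ('e \<Rightarrow>\<^sub>L 'e) set) \<Rightarrow> bool" where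
  "almost_quaternionic M \<A> Q \<longleftrightarrow>
     (\<forall>p\<in>topspace M. \<exists>U J. p \<in> U \<and> admissible_basis M \<A> Q U J)"

definition almost_qsH ::
    "'m topology \<Rightarrow> ('m, 'e::euclidean_space) atlas \<Rightarrow> ('m \<Rightarrow> ('e \<Rightarrow>\<^sub>L 'e) set) \<Rightarrow>
     ('m \<Rightarrow> 'e \<Rightarrow> 'e \<Rightarrow> real) \<Rightarrow> bool" where
  "almost_qsH M \<A> Q \<omega> \<longleftrightarrow> almost_quaternionic M \<A> Q \<and> nondegenerate_two_form M \<A> \<omega> \<and>
     (\<forall>U J. admissible_basis M \<A> Q U J \<longrightarrow>
        (\<forall>a\<in>{1,2,3}. \<forall>p\<in>U. \<forall>u v. \<omega> p (J a p u) (J a p v) = \<omega> p u v))"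

section \<open>Nijenhuis tensor and integrability\<close>

definition nijenhuis ::
    "('m, 'e::euclidean_space) atlas \<Rightarrow> ('m, 'e) endo_field \<Rightarrow> ('m, 'e) field_op" where
  "nijenhuis \<A> J X Y p =
     lie_bracket \<A> (app_field J X) (app_field J Y) p
     - app_field J (lie_bracket \<A> (app_field J X) Y) p
     - app_field J (lie_bracket \<A> X (app_field J Y)) p
     - lie_bracket \<A> X Y p"

text \<open>An almost complex structure is called integrable if its Nijenhuis tensor vanishes.\<close>

definition integrable_acs ::
    "'m topology \<Rightarrow> ('m, 'e::euclidean_space) atlas \<Rightarrow> 'm set \<Rightarrow> ('m, 'e) endo_field \<Rightarrow> bool" where
  "integrable_acs M \<A> U J \<longleftrightarrow>
     (\<forall>V. openin M V \<and> V \<subseteq> U \<longrightarrow>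
       (\<forall>X\<in>vector_fields \<A> V. \<forall>Y\<in>vector_fields \<A> V. \<forall>p\<in>V. nijenhuis \<A> J X Y p = 0))"

section \<open>The adapted connection\<close>

text \<open>The Obata connection of the almost hypercomplex structure \<open>J\<close> is the unique connection with
  \<open>\<nabla>J\<^sub>a = 0\<close> and this torsion; only the torsion enters below.\<close>

definition obata_torsion ::
    "('m, 'e::euclidean_space) atlas \<Rightarrow> (nat \<Rightarrow> ('m, 'e) endo_field) \<Rightarrow> ('m, 'e) field_op" where
  "obata_torsion \<A> J X Y p = (1/6) *\<^sub>R (\<Sum>a\<in>{1,2,3}. nijenhuis \<A> (J a) X Y p)"

definition obata_trace_form ::
    "'m topology \<Rightarrow> ('m, 'e::euclidean_space) atlas \<Rightarrow> nat \<Rightarrow> (nat \<Rightarrow> ('m, 'e) endo_field) \<Rightarrow>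
     nat \<Rightarrow> 'm \<Rightarrow> 'e \<Rightarrow> real" where
  "obata_trace_form M \<A> n J a p u =
     1 / (4 * real n - 2) *
     endo_trace (\<lambda>v. J a p (tensor_at M \<A> (obata_torsion \<A> J) p u v))"

definition del_form_endo :: "('m \<Rightarrow> 'e \<Rightarrow> real) \<Rightarrow> ('m, 'e::euclidean_space) endo_field \<Rightarrow> ('m, 'e) field_op" where
  "del_form_endo \<tau> J X Y p = \<tau> p (X p) *\<^sub>R J p (Y p) - \<tau> p (Y p) *\<^sub>R J p (X p)"

definition unimodular_oproiu_connection ::
    "'m topology \<Rightarrow> ('m, 'e::euclidean_space) atlas \<Rightarrow> nat \<Rightarrow> ('m \<Rightarrow> ('e \<Rightarrow>\<^sub>L 'e) set) \<Rightarrow>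
     ('m \<Rightarrow> 'e \<Rightarrow> 'e \<Rightarrow> real) \<Rightarrow> ('m, 'e) field_op \<Rightarrow> bool" where
  "unimodular_oproiu_connection M \<A> n Q \<omega> D \<longleftrightarrow>
     affine_connection M \<A> D \<and> preserves_bundle M \<A> D Q \<and>
     preserves_form M \<A> D (4*n) (\<lambda>p. wedge_power (\<omega> p) (2*n)) \<and>
     (\<forall>U J V. admissible_basis M \<A> Q U J \<and> openin M V \<and> V \<subseteq> U \<longrightarrow>
       (\<forall>X\<in>vector_fields \<A> V. \<forall>Y\<in>vector_fields \<A> V. \<forall>p\<in>V.
          torsion \<A> D X Y p = obata_torsion \<A> J X Y p
            + (\<Sum>a\<in>{1,2,3}. del_form_endo (obata_trace_form M \<A> n J a) (J a) X Y p)))"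

text \<open>The tensor \<open>A\<close> with \<open>\<omega>(A(X,Y),Z) = 1/2 (\<nabla>\<^sub>X \<omega>)(Y,Z)\<close>, and the connection \<open>\<nabla> + A\<close>.\<close>

definition omega_correction ::
    "'m topology \<Rightarrow> ('m, 'e::euclidean_space) atlas \<Rightarrow> ('m \<Rightarrow> 'e \<Rightarrow> 'e \<Rightarrow> real) \<Rightarrow>
     ('m, 'e) field_op \<Rightarrow> ('m \<Rightarrow> 'e \<Rightarrow> 'e \<Rightarrow> 'e) \<Rightarrow> bool" where
  "omega_correction M \<A> \<omega> D A \<longleftrightarrow>
     (\<forall>V X Y Z. openin M V \<and> X \<in> vector_fields \<A> V \<and> Y \<in> vector_fields \<A> V \<and> Z \<in> vector_fields \<A> V \<longrightarrow>
       (\<forall>p\<in>V. \<omega> p (A p (X p) (Y p)) (Z p) = 1/2 * cov_two_form \<A> D X \<omega> Y Z p))"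

definition add_tensor ::
    "('m, 'e::euclidean_space) field_op \<Rightarrow> ('m \<Rightarrow> 'e \<Rightarrow> 'e \<Rightarrow> 'e) \<Rightarrow> ('m, 'e) field_op" where
  "add_tensor D A X Y p = D X Y p + A p (X p) (Y p)"

definition adapted_connection ::
    "'m topology \<Rightarrow> ('m, 'e::euclidean_space) atlas \<Rightarrow> nat \<Rightarrow> ('m \<Rightarrow> ('e \<Rightarrow>\<^sub>L 'e) set) \<Rightarrow>
     ('m \<Rightarrow> 'e \<Rightarrow> 'e \<Rightarrow> real) \<Rightarrow> ('m, 'e) field_op \<Rightarrow> bool" where
  "adapted_connection M \<A> n Q \<omega> D \<longleftrightarrow>
     (\<exists>D0 A. unimodular_oproiu_connection M \<A> n Q \<omega> D0 \<and> omega_correction M \<A> \<omega> D0 A \<and>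
        D = add_tensor D0 A)"

definition cyclic_triples :: "(nat \<times> nat \<times> nat) set" where
  "cyclic_triples = {(1,2,3), (2,3,1), (3,1,2)}"

definition connection_forms ::
    "'m topology \<Rightarrow> ('m, 'e::euclidean_space) atlas \<Rightarrow> 'm set \<Rightarrow> ('m, 'e) field_op \<Rightarrow>
     (nat \<Rightarrow> ('m, 'e) endo_field) \<Rightarrow> (nat \<Rightarrow> 'm \<Rightarrow> 'e \<Rightarrow> real) \<Rightarrow> bool" where
  "connection_forms M \<A> U D J \<gamma> \<longleftrightarrow>
     (\<forall>a\<in>{1,2,3}. one_form M \<A> U (\<gamma> a)) \<and>
     (\<forall>(a,b,c)\<in>cyclic_triples. \<forall>V. openin M V \<and> V \<subseteq> U \<longrightarrow>
       (\<forall>X\<in>vector_fields \<A> V. \<forall>Y\<in>vector_fields \<A> V. \<forall>p\<in>V.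
          cov_endo D X (J a) Y p = \<gamma> c p (X p) *\<^sub>R J b p (Y p) - \<gamma> b p (X p) *\<^sub>R J c p (Y p)))"

section \<open>The operator \<open>\<pi>\<^sub>J\<close>\<close>

definition proj_acs ::
    "('m, 'e::euclidean_space) endo_field \<Rightarrow> ('m, 'e) field_op \<Rightarrow> ('m, 'e) field_op" where
  "proj_acs J \<phi> X Y p = (1/4) *\<^sub>R
     (\<phi> X Y p + J p (\<phi> (app_field J X) Y p + \<phi> X (app_field J Y) p)
      - \<phi> (app_field J X) (app_field J Y) p)"

end

theory Submission
  imports Defs "HOL-Computational_Algebra.Polynomial"
begin

text \<open>
  For a connection with \<open>\<nabla>J\<^sub>a = \<gamma>\<^sub>c J\<^sub>b - \<gamma>\<^sub>b J\<^sub>c\<close> and torsion \<open>T\<close> one has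
  \<open>N\<^bsub>J\<^sub>a\<^esub> = 4 \<pi>\<^bsub>J\<^sub>a\<^esub>(T) + \<Psi>\<close>, where \<open>\<Psi>\<close> is the left-hand side of the second condition. Hence the two
  conditions imply integrability. Conversely, \<open>A\<^sub>X\<close> commutes with \<open>J\<^sub>a\<close>, so that
  \<open>\<pi>\<^bsub>J\<^sub>a\<^esub>\<close> does not distinguish the torsions of the adapted and the unimodular Oproiu connection.
  The traces \<open>\<tau>\<^sub>a\<close> in the latter are such that \<open>tr (J\<^sub>b \<circ> \<pi>\<^bsub>J\<^sub>a\<^esub>(T)\<^sub>X) = 0\<close>, whereas
  \<open>tr (J\<^sub>b \<circ> \<Psi>\<^sub>X) = - (4n - 2) \<psi>\<^sub>a(X)\<close>. So \<open>N\<^bsub>J\<^sub>a\<^esub> = 0\<close> forces \<open>\<psi>\<^sub>a = 0\<close>, and both conditions follow.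
  Global vector fields suffice in the conditions because of bump functions.
\<close>

section \<open>Calculus of smooth maps\<close>

lemma Ck_on_subset: "Ck_on k S f \<Longrightarrow> T \<subseteq> S \<Longrightarrow> Ck_on k T f"
  by (induction k arbitrary: f) (auto intro: continuous_on_subset)

lemma Ck_on_Suc_imp: "Ck_on (Suc k) S f \<Longrightarrow> Ck_on k S f"
proof (induction k arbitrary: f)
  case 0
  then show ?case
    by (auto intro!: continuous_at_imp_continuous_on differentiable_imp_continuous_within)
next
  case (Suc k)
  then show ?case by (metis Ck_on.simps(2))
qed

lemma Ck_on_cong:
  assumes "open S" "\<And>x. x \<in> S \<Longrightarrow> f x = g x" "Ck_on k S f"
  shows "Ck_on k S g"
  using assms(2,3)
proof (induction k arbitrary: f g)
  case 0
  then show ?case by (metis Ck_on.simps(1) continuous_on_cong)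
next
  case (Suc k)
  have d: "f differentiable (at x)" if "x \<in> S" for x
    using Suc.prems(2) that by simp
  have dg: "g differentiable (at x)" if "x \<in> S" for x
    using d[OF that] Suc.prems(1) \<open>open S\<close> that
    by (meson differentiable_def has_derivative_transform_within_open)
  have "frechet_derivative f (at x) = frechet_derivative g (at x)" if "x \<in> S" for x
    using frechet_derivative_transform_within_open[OF d[OF that] \<open>open S\<close> that] Suc.prems(1) by blast
  then have "Ck_on k S (\<lambda>x. frechet_derivative g (at x) v)" for v
    using Suc.IH[of "\<lambda>x. frechet_derivative f (at x) v" "\<lambda>x. frechet_derivative g (at x) v"]
      Suc.prems(2) by auto
  then show ?case using dg by simp
qed

text \<open>Derivatives are unique, so an explicit family \<open>f'\<close> may stand in for the
  chosen \<open>frechet_derivative\<close>. The closure properties below use this as their induction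
  step.\<close>

lemma Ck_on_SucI:
  assumes "open S" "\<And>x. x \<in> S \<Longrightarrow> (f has_derivative f' x) (at x)"
    and "\<And>v. Ck_on k S (\<lambda>x. f' x v)"
  shows "Ck_on (Suc k) S f"
proof -
  have eq: "f' x = frechet_derivative f (at x)" if "x \<in> S" for x
    by (rule frechet_derivative_at[OF assms(2)[OF that]])
  have "Ck_on k S (\<lambda>x. frechet_derivative f (at x) v)" for v
    by (rule Ck_on_cong[OF \<open>open S\<close> _ assms(3)[of v]]) (simp add: eq)
  moreover have "f differentiable (at x)" if "x \<in> S" for x
    using assms(2)[OF that] differentiableI by blast
  ultimately show ?thesis by simp
qed

lemma Ck_on_Suc_has_derivative:
  "Ck_on (Suc k) S f \<Longrightarrow> x \<in> S \<Longrightarrow> (f has_derivative frechet_derivative f (at x)) (at x)"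
  using frechet_derivative_works by auto

text \<open>Differentiability is a pointwise condition, so only the continuity at level 0 uses
  openness. This serves to glue a cut-off vector field along two open sets.\<close>

lemma Ck_on_Un:
  "open S \<Longrightarrow> open T \<Longrightarrow> Ck_on k S f \<Longrightarrow> Ck_on k T f \<Longrightarrow> Ck_on k (S \<union> T) f"
  by (induction k arbitrary: f) (auto intro: continuous_on_open_Un)

lemma Ck_on_const: "open S \<Longrightarrow> Ck_on k S (\<lambda>x. c)"
proof (induction k arbitrary: c)
  case (Suc k)
  show ?case by (rule Ck_on_SucI[where f' = "\<lambda>x v. 0"]) (use Suc in auto)
qed auto

lemma Ck_on_linear:
  assumes "bounded_linear L" "open S" "Ck_on k S f"
  shows "Ck_on k S (\<lambda>x. L (f x))"
  using assms(3)
proof (induction k arbitrary: f)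
  case 0
  then show ?case using assms(1) bounded_linear.continuous_on by auto
next
  case (Suc k)
  show ?case
    by (rule Ck_on_SucI[OF assms(2)
          bounded_linear.has_derivative[OF assms(1) Ck_on_Suc_has_derivative[OF Suc.prems]]])
      (use Suc in auto)
qed

lemma Ck_on_add:
  assumes "open S" "Ck_on k S f" "Ck_on k S g"
  shows "Ck_on k S (\<lambda>x. f x + g x)"
  using assms(2,3)
proof (induction k arbitrary: f g)
  case (Suc k)
  show ?case
    by (rule Ck_on_SucI[OF assms(1) has_derivative_add[OF
            Ck_on_Suc_has_derivative[OF Suc.prems(1)] Ck_on_Suc_has_derivative[OF Suc.prems(2)]]])
      (use Suc in auto)
qed (auto intro: continuous_on_add)

lemma Ck_on_sum:
  "open S \<Longrightarrow> (\<And>i. i \<in> I \<Longrightarrow> Ck_on k S (f i)) \<Longrightarrow> Ck_on k S (\<lambda>x. \<Sum>i\<in>I. f i x)"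
  by (induction I rule: infinite_finite_induct) (auto intro: Ck_on_add Ck_on_const)

lemma Ck_on_scaleR:
  fixes f :: "'a::real_normed_vector \<Rightarrow> real" and g :: "'a \<Rightarrow> 'b::real_normed_vector"
  assumes "open S" "Ck_on k S f" "Ck_on k S g"
  shows "Ck_on k S (\<lambda>x. f x *\<^sub>R g x)"
  using assms(2,3)
proof (induction k arbitrary: f g)
  case (Suc k)
  have "Ck_on k S f" "Ck_on k S g" using Suc.prems by (auto intro: Ck_on_Suc_imp)
  then show ?case using Suc
    by (intro Ck_on_SucI[OF assms(1) has_derivative_scaleR[OF
            Ck_on_Suc_has_derivative[OF Suc.prems(1)] Ck_on_Suc_has_derivative[OF Suc.prems(2)]]]
          Ck_on_add[OF assms(1)]) auto
qed (auto intro: continuous_on_scaleR)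

lemma Ck_on_compose:
  fixes g :: "'a::real_normed_vector \<Rightarrow> 'b::euclidean_space" and f :: "'b \<Rightarrow> 'c::real_normed_vector"
  assumes "open S" "open T" "g ` S \<subseteq> T" "Ck_on k S g" "Ck_on k T f"
  shows "Ck_on k S (\<lambda>x. f (g x))"
  using assms(4,5)
proof (induction k arbitrary: f)
  case 0
  then show ?case using assms(3) continuous_on_compose2[of T f S g] by auto
next
  case (Suc k)
  let ?f' = "\<lambda>y. frechet_derivative f (at y)" and ?g' = "\<lambda>x. frechet_derivative g (at x)"
  have T: "g x \<in> T" if "x \<in> S" for x using assms(3) that by auto
  have d: "((\<lambda>x. f (g x)) has_derivative (\<lambda>v. ?f' (g x) (?g' x v))) (at x)" if "x \<in> S" for x
    using diff_chain_at[OF Ck_on_Suc_has_derivative[OF Suc.prems(1) that]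
        Ck_on_Suc_has_derivative[OF Suc.prems(2) T[OF that]]]
    by (simp add: o_def)
  \<comment> \<open>The direction \<open>?g' x v\<close> moves with \<open>x\<close>, while
    \<open>Ck_on\<close> controls \<open>?f'\<close> in fixed directions only. Expanding over
    \<open>Basis\<close> leaves scalar coefficients times \<open>?f' (g x) i\<close>, and the
    induction hypothesis applies to the latter with the same \<open>g\<close>.\<close>
  have "Ck_on k S (\<lambda>x. ?f' (g x) (?g' x v))" for v
  proof (rule Ck_on_cong[OF assms(1)])
    show "(\<Sum>i\<in>Basis. (?g' x v \<bullet> i) *\<^sub>R ?f' (g x) i) = ?f' (g x) (?g' x v)" if "x \<in> S" for x
    proof -
      have "linear (?f' (g x))"
        using Ck_on_Suc_has_derivative[OF Suc.prems(2) T[OF that]] has_derivative_linear by blast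
      then have "?f' (g x) (\<Sum>i\<in>Basis. (?g' x v \<bullet> i) *\<^sub>R i) = (\<Sum>i\<in>Basis. (?g' x v \<bullet> i) *\<^sub>R ?f' (g x) i)"
        by (simp add: linear_sum linear_scale)
      then show ?thesis by (simp add: euclidean_representation)
    qed
    show "Ck_on k S (\<lambda>x. \<Sum>i\<in>Basis. (?g' x v \<bullet> i) *\<^sub>R ?f' (g x) i)"
    proof (intro Ck_on_sum Ck_on_scaleR assms(1))
      show "Ck_on k S (\<lambda>x. ?g' x v \<bullet> i)" for i
        using Suc.prems(1) by (intro Ck_on_linear[OF bounded_linear_inner_left assms(1)]) simp
      show "Ck_on k S (\<lambda>x. ?f' (g x) i)" for i
        using Suc.IH[of "\<lambda>y. ?f' y i"] Suc.prems Ck_on_Suc_imp by auto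
    qed
  qed
  then show ?case
    using Ck_on_SucI[OF assms(1), of "\<lambda>x. f (g x)" "\<lambda>x v. ?f' (g x) (?g' x v)"] d by blast
qed

section \<open>Passage from finite order to smooth maps\<close>

lemma smooth_on_has_derivative:
  "smooth_on S f \<Longrightarrow> x \<in> S \<Longrightarrow> (f has_derivative frechet_derivative f (at x)) (at x)"
  unfolding smooth_on_def using Ck_on_Suc_has_derivative by blast

lemma smooth_on_frechet_derivative:
  "smooth_on S f \<Longrightarrow> smooth_on S (\<lambda>x. frechet_derivative f (at x) v)"
  unfolding smooth_on_def by (metis Ck_on.simps(2))

lemma smooth_on_subset: "smooth_on S f \<Longrightarrow> T \<subseteq> S \<Longrightarrow> smooth_on T f"
  unfolding smooth_on_def using Ck_on_subset by blast

lemma smooth_on_cong: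
  "open S \<Longrightarrow> (\<And>x. x \<in> S \<Longrightarrow> f x = g x) \<Longrightarrow> smooth_on S f \<Longrightarrow> smooth_on S g"
  unfolding smooth_on_def using Ck_on_cong by blast

lemma smooth_on_compose:
  fixes g :: "'a::real_normed_vector \<Rightarrow> 'b::euclidean_space" and f :: "'b \<Rightarrow> 'c::real_normed_vector"
  assumes "open S" "open T" "g ` S \<subseteq> T" "smooth_on S g" "smooth_on T f"
  shows "smooth_on S (\<lambda>x. f (g x))"
  using assms Ck_on_compose unfolding smooth_on_def by blast

lemma smooth_on_scaleR:
  fixes f :: "'a::real_normed_vector \<Rightarrow> real" and g :: "'a \<Rightarrow> 'b::real_normed_vector"
  assumes "open S" "smooth_on S f" "smooth_on S g"
  shows "smooth_on S (\<lambda>x. f x *\<^sub>R g x)"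
  using assms Ck_on_scaleR unfolding smooth_on_def by blast

section \<open>Bump functions\<close>

text \<open>Allowing a polynomial in \<open>1 / t\<close> makes this family of flat functions closed
  under differentiation; \<open>P = 1\<close> is the classical smooth function that is not analytic
  at 0.\<close>

definition exp_recip :: "real poly \<Rightarrow> real \<Rightarrow> real" where
  "exp_recip P t = (if t > 0 then poly P (1 / t) * exp (- (1 / t)) else 0)"

text \<open>With \<open>s = 1 / t\<close> this becomes the limit 0 of \<open>exp_recip P\<close> at
  0 from the right.\<close>

lemma poly_exp_decay: "((\<lambda>s::real. poly P s * exp (- s)) \<longlongrightarrow> 0) at_top"
proof -
  have "((\<lambda>s::real. \<Sum>i\<le>degree P. coeff P i * (s ^ i / exp s)) \<longlongrightarrow> (\<Sum>i\<le>degree P. coeff P i * 0)) at_top"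
    by (intro tendsto_intros tendsto_power_div_exp_0)
  moreover have "(\<lambda>s::real. \<Sum>i\<le>degree P. coeff P i * (s ^ i / exp s)) = (\<lambda>s. poly P s * exp (- s))"
    by (auto simp: poly_altdef exp_minus sum_distrib_right sum_divide_distrib field_simps)
  ultimately show ?thesis by simp
qed

lemma exp_recip_tendsto_0: "(exp_recip P \<longlongrightarrow> 0) (at 0)"
proof -
  have "((\<lambda>t::real. poly P (inverse t) * exp (- inverse t)) \<longlongrightarrow> 0) (at_right 0)"
    using filterlim_compose[OF poly_exp_decay filterlim_inverse_at_top_right] by simp
  then have "(exp_recip P \<longlongrightarrow> 0) (at_right 0)"
    by (rule Lim_transform_eventually)
      (auto simp: exp_recip_def eventually_at_right_less inverse_eq_divide intro!: eventually_at_rightI[of 0 1])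
  moreover have "(exp_recip P \<longlongrightarrow> 0) (at_left 0)"
    by (rule Lim_transform_eventually[OF tendsto_const])
      (auto simp: exp_recip_def intro!: eventually_at_leftI[of "-1" 0])
  ultimately show ?thesis by (simp add: filterlim_split_at)
qed

text \<open>With \<open>s = 1 / t\<close> one has d/dt = - s^2 d/ds, which sends P(s) exp(-s) to s^2
  (P - P')(s) exp(-s); the factor s^2 is \<open>monom 1 2\<close>.\<close>

lemma exp_recip_has_derivative:
  "(exp_recip P has_real_derivative exp_recip (monom 1 2 * (P - pderiv P)) t) (at t)"
proof -
  consider "t > 0" | "t < 0" | "t = 0" by linarith
  then show ?thesis
  proof cases
    case 1
    have inv: "((\<lambda>t. 1 / t) has_real_derivative - (1 / t)\<^sup>2) (at t)"
      using DERIV_inverse[of t] 1 by (simp add: inverse_eq_divide power2_eq_square)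
    have "((\<lambda>t. poly P (1 / t) * exp (- (1 / t))) has_real_derivative
        poly (pderiv P) (1 / t) * - (1 / t)\<^sup>2 * exp (- (1 / t)) +
        exp (- (1 / t)) * - (- (1 / t)\<^sup>2) * poly P (1 / t)) (at t)"
      by (intro DERIV_mult DERIV_chain2[OF poly_DERIV inv] DERIV_chain2[OF DERIV_exp]
          DERIV_minus inv)
    also have "poly (pderiv P) (1 / t) * - (1 / t)\<^sup>2 * exp (- (1 / t)) +
        exp (- (1 / t)) * - (- (1 / t)\<^sup>2) * poly P (1 / t) =
        exp_recip (monom 1 2 * (P - pderiv P)) t"
      using 1 by (simp add: exp_recip_def poly_monom algebra_simps)
    finally have "((\<lambda>t. poly P (1 / t) * exp (- (1 / t))) has_real_derivative
        exp_recip (monom 1 2 * (P - pderiv P)) t) (at t)" .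
    then show ?thesis
      by (rule has_field_derivative_transform_within_open[of _ _ _ "{0<..}"])
        (use 1 in \<open>auto simp: exp_recip_def\<close>)
  next
    case 2
    have "((\<lambda>t. 0) has_real_derivative exp_recip (monom 1 2 * (P - pderiv P)) t) (at t)"
      using 2 by (auto simp: exp_recip_def)
    then show ?thesis
      by (rule has_field_derivative_transform_within_open[of _ _ _ "{..<0}"])
        (use 2 in \<open>auto simp: exp_recip_def\<close>)
  next
    case 3
    \<comment> \<open>The difference quotient at 0 has one more factor \<open>1 / h\<close>, so it
      is the member of the family for s P(s) and tends to 0. At \<open>h = 0\<close> both sides are
      0, the left one by the convention for division by zero.\<close>
    have "(\<lambda>h. (exp_recip P (0 + h) - exp_recip P 0) / h) = exp_recip (monom 1 1 * P)"
      by (auto simp: exp_recip_def poly_monom)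
    then show ?thesis
      using exp_recip_tendsto_0[of "monom 1 1 * P"] 3 by (simp add: DERIV_def exp_recip_def)
  qed
qed

lemma Ck_on_exp_recip: "Ck_on k UNIV (exp_recip P)"
proof (induction k arbitrary: P)
  case 0
  show ?case
    by (simp add: continuous_at_imp_continuous_on DERIV_isCont[OF exp_recip_has_derivative])
next
  case (Suc k)
  show ?case
  proof (rule Ck_on_SucI)
    show "(exp_recip P has_derivative (\<lambda>v. v *\<^sub>R exp_recip (monom 1 2 * (P - pderiv P)) t)) (at t)" for t
      using exp_recip_has_derivative[of P t]
      unfolding has_field_derivative_def real_scaleR_def mult.commute[of _ "exp_recip _ t"] .
    show "Ck_on k UNIV (\<lambda>t. v *\<^sub>R exp_recip (monom 1 2 * (P - pderiv P)) t)" for v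
      by (intro Ck_on_linear[OF bounded_linear_scaleR_right] Suc open_UNIV)
  qed simp
qed

lemma Ck_on_sq_dist: "Ck_on k UNIV (\<lambda>y::'e::euclidean_space. r\<^sup>2 - (y - y0) \<bullet> (y - y0))"
proof -
  have lin: "Ck_on k UNIV (\<lambda>y::'e. v \<bullet> y)" for k v
  proof (cases k)
    case (Suc j)
    show ?thesis unfolding Suc
      by (rule Ck_on_SucI[where f' = "\<lambda>_. \<lambda>y. v \<bullet> y"])
        (auto intro!: derivative_eq_intros Ck_on_const)
  qed (auto intro!: continuous_intros)
  show ?thesis
  proof (cases k)
    case (Suc j)
    have 1: "- 2 * ((y - y0) \<bullet> v) = (- 2 *\<^sub>R v) \<bullet> y + 2 * (y0 \<bullet> v)" for y v :: 'e
      by (simp add: inner_diff_left inner_commute algebra_simps)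
    show ?thesis unfolding Suc
    proof (rule Ck_on_SucI[where f' = "\<lambda>y v. - 2 * ((y - y0) \<bullet> v)"])
      show "((\<lambda>y. r\<^sup>2 - (y - y0) \<bullet> (y - y0)) has_derivative (\<lambda>v. - 2 * ((y - y0) \<bullet> v))) (at y)" for y
        by (auto intro!: derivative_eq_intros simp: inner_commute)
      show "Ck_on j UNIV (\<lambda>y. - 2 * ((y - y0) \<bullet> v))" for v
        unfolding 1 by (intro Ck_on_add lin Ck_on_const) auto
    qed auto
  qed (auto intro!: continuous_intros)
qed

lemma smooth_bump:
  fixes y0 :: "'e::euclidean_space"
  assumes "r > 0"
  obtains \<phi> :: "'e \<Rightarrow> real" where "smooth_on UNIV \<phi>" "\<phi> y0 = 1" "\<And>y. y \<notin> cball y0 r \<Longrightarrow> \<phi> y = 0"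
proof
  let ?g = "\<lambda>y::'e. r\<^sup>2 - (y - y0) \<bullet> (y - y0)"
  \<comment> \<open>The factor \<open>exp (1 / r\<^sup>2)\<close> normalises the value at
    \<open>y0\<close>, where \<open>?g\<close> equals \<open>r\<^sup>2\<close>. Outside the ball
    \<open>?g\<close> is not positive, so \<open>exp_recip\<close> takes its value 0.\<close>
  let ?f = "\<lambda>y::'e. exp (1 / r\<^sup>2) *\<^sub>R exp_recip 1 (?g y)"
  show "smooth_on UNIV ?f"
    unfolding smooth_on_def
    by (intro allI Ck_on_linear[OF bounded_linear_scaleR_right] open_UNIV subset_UNIV
        Ck_on_compose[OF _ _ _ Ck_on_sq_dist Ck_on_exp_recip])
  show "?f y0 = 1" using assms by (simp add: exp_recip_def exp_minus)
  show "?f y = 0" if "y \<notin> cball y0 r" for y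
  proof -
    have "r < norm (y - y0)" using that by (simp add: dist_norm norm_minus_commute)
    then have "r\<^sup>2 \<le> (norm (y - y0))\<^sup>2" using assms by (simp add: power_mono)
    then show ?thesis by (simp add: exp_recip_def dot_square_norm)
  qed
qed

section \<open>Charts and vector fields\<close>

text \<open>The Jacobian at \<open>q\<close> of the change from chart \<open>c\<close> to chart
  \<open>d\<close>. In \<open>components_in\<close> the source is always \<open>chart_at\<close>; a
  free source chart allows the chain rule to be stated as a cocycle identity.\<close>

definition transition_deriv ::
    "('m, 'e::euclidean_space) chart \<Rightarrow> ('m, 'e) chart \<Rightarrow> 'm \<Rightarrow> 'e \<Rightarrow> 'e" where
  "transition_deriv c d q = frechet_derivative (snd d \<circ> chart_inv c) (at (snd c q))"

lemma components_in_eq: "components_in \<A> c q = transition_deriv (chart_at \<A> q) c q"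
  by (simp add: components_in_def transition_deriv_def)

lemma vector_fields_mono: "X \<in> vector_fields \<A> W \<Longrightarrow> V \<subseteq> W \<Longrightarrow> X \<in> vector_fields \<A> V"
  unfolding vector_fields_def by (blast intro: smooth_on_subset)

locale manifold =
  fixes M :: "'m topology" and \<A> :: "('m, 'e::euclidean_space) atlas"
  assumes smooth: "smooth_manifold M \<A>"
begin

lemma chart_at:
  assumes "p \<in> topspace M"
  shows "chart_at \<A> p \<in> \<A>" "p \<in> fst (chart_at \<A> p)"
proof -
  have "\<exists>c. c \<in> \<A> \<and> p \<in> fst c" using smooth assms unfolding smooth_manifold_def by blast
  from someI_ex[OF this] show "chart_at \<A> p \<in> \<A>" "p \<in> fst (chart_at \<A> p)"
    unfolding chart_at_def by auto
qed

lemma is_chart: "c \<in> \<A> \<Longrightarrow> is_chart M c"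
  using smooth by (simp add: smooth_manifold_def)

lemma openin_chart: "c \<in> \<A> \<Longrightarrow> openin M (fst c)"
  using is_chart by (simp add: is_chart_def)

lemma chart_subset: "c \<in> \<A> \<Longrightarrow> fst c \<subseteq> topspace M"
  using openin_chart openin_subset by blast

lemma chart_homeo:
  "c \<in> \<A> \<Longrightarrow> homeomorphic_map (subtopology M (fst c)) (top_of_set (snd c ` fst c)) (snd c)"
  using is_chart by (simp add: is_chart_def)

lemma chart_inj: "c \<in> \<A> \<Longrightarrow> inj_on (snd c) (fst c)"
  using homeomorphic_imp_injective_map[OF chart_homeo] chart_subset
  by (metis topspace_subtopology_subset)

lemma chart_inv [simp]: "c \<in> \<A> \<Longrightarrow> q \<in> fst c \<Longrightarrow> chart_inv c (snd c q) = q"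
  by (simp add: chart_inv_def chart_inj)

lemma open_chart_image:
  assumes c: "c \<in> \<A>" and V: "openin M V"
  shows "open (snd c ` (fst c \<inter> V))"
proof -
  have "openin (subtopology M (fst c)) (fst c \<inter> V)"
    using V by (metis inf_commute openin_subtopology)
  then have "openin (top_of_set (snd c ` fst c)) (snd c ` (fst c \<inter> V))"
    using homeomorphic_imp_open_map[OF chart_homeo[OF c]] by (auto simp: open_map_def)
  moreover have "open (snd c ` fst c)" using is_chart[OF c] by (simp add: is_chart_def)
  ultimately show ?thesis using openin_open_trans by blast
qed

lemma smooth_transition:
  "c \<in> \<A> \<Longrightarrow> d \<in> \<A> \<Longrightarrow> smooth_on (snd c ` (fst c \<inter> fst d)) (snd d \<circ> chart_inv c)"
  using smooth by (simp add: smooth_manifold_def)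

lemma transition_has_derivative:
  assumes "c \<in> \<A>" "d \<in> \<A>" "q \<in> fst c" "q \<in> fst d"
  shows "((snd d \<circ> chart_inv c) has_derivative transition_deriv c d q) (at (snd c q))"
  unfolding transition_deriv_def
  by (rule smooth_on_has_derivative[OF smooth_transition[OF assms(1,2)]]) (use assms in auto)

lemma linear_transition_deriv:
  "c \<in> \<A> \<Longrightarrow> d \<in> \<A> \<Longrightarrow> q \<in> fst c \<Longrightarrow> q \<in> fst d \<Longrightarrow> linear (transition_deriv c d q)"
  using transition_has_derivative has_derivative_linear by blast

text \<open>Chain rule. The composite of the two changes of charts agrees with the direct change
  only over the overlap of \<open>c\<close> and \<open>d\<close>, which is open and contains
  \<open>q\<close>.\<close>

lemma transition_deriv_trans:
  assumes "c \<in> \<A>" "d \<in> \<A>" "e \<in> \<A>" "q \<in> fst c" "q \<in> fst d" "q \<in> fst e"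
  shows "transition_deriv d e q (transition_deriv c d q w) = transition_deriv c e q w"
proof -
  have q: "(snd d \<circ> chart_inv c) (snd c q) = snd d q" using assms by simp
  have "((snd e \<circ> chart_inv d) \<circ> (snd d \<circ> chart_inv c) has_derivative
      transition_deriv d e q \<circ> transition_deriv c d q) (at (snd c q))"
    by (rule diff_chain_at[OF transition_has_derivative])
      (use assms transition_has_derivative[of d e q] q in auto)
  then have "(snd e \<circ> chart_inv c has_derivative
      transition_deriv d e q \<circ> transition_deriv c d q) (at (snd c q))"
  proof (rule has_derivative_transform_within_open)
    show "open (snd c ` (fst c \<inter> fst d))" using assms open_chart_image openin_chart by blast
  qed (use assms in auto)
  then show ?thesis
    unfolding transition_deriv_def[of c e q] by (metis comp_apply frechet_derivative_at)
qed

lemma transition_deriv_self: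
  assumes "c \<in> \<A>" "q \<in> fst c"
  shows "transition_deriv c c q w = w"
proof -
  have "((\<lambda>y. y) has_derivative (\<lambda>y. y)) (at (snd c q))" by simp
  then have "(snd c \<circ> chart_inv c has_derivative (\<lambda>y. y)) (at (snd c q))"
  proof (rule has_derivative_transform_within_open)
    show "open (snd c ` (fst c \<inter> topspace M))" using assms open_chart_image by blast
  qed (use assms chart_subset[OF assms(1)] in auto)
  then show ?thesis unfolding transition_deriv_def by (metis frechet_derivative_at)
qed

lemma components_in_self: "p \<in> topspace M \<Longrightarrow> components_in \<A> (chart_at \<A> p) p w = w"
  using transition_deriv_self chart_at by (simp add: components_in_eq)

lemma linear_components_in:
  "c \<in> \<A> \<Longrightarrow> q \<in> fst c \<Longrightarrow> linear (components_in \<A> c q)"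
  using linear_transition_deriv chart_at chart_subset unfolding components_in_eq by blast

lemma local_rep_chart:
  "c \<in> \<A> \<Longrightarrow> q \<in> fst c \<Longrightarrow> local_rep \<A> c X (snd c q) = components_in \<A> c q (X q)"
  by (simp add: local_rep_def)

section \<open>Vector fields and functions read in charts\<close>

lemma vector_field_has_derivative:
  assumes "X \<in> vector_fields \<A> V" "c \<in> \<A>" "q \<in> fst c \<inter> V"
  shows "(local_rep \<A> c X has_derivative frechet_derivative (local_rep \<A> c X) (at (snd c q)))
    (at (snd c q))"
  by (rule smooth_on_has_derivative[where S = "snd c ` (fst c \<inter> V)"])
    (use assms in \<open>auto simp: vector_fields_def\<close>)

text \<open>The negative is written as a multiple by the constant -1, the form in which the Leibniz
  rule of a connection applies to it.\<close>

lemma vector_fields_uminus: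
  assumes "openin M V" "Y \<in> vector_fields \<A> V"
  shows "(\<lambda>q. (-1) *\<^sub>R Y q) \<in> vector_fields \<A> V"
  unfolding vector_fields_def
proof safe
  fix c assume c: "c \<in> \<A>"
  let ?S = "snd c ` (fst c \<inter> V)"
  have op: "open ?S" using open_chart_image[OF c assms(1)] .
  have "smooth_on ?S (\<lambda>y. (-1) *\<^sub>R local_rep \<A> c Y y)"
    using assms(2) c op Ck_on_linear[OF bounded_linear_scaleR_right op]
    by (simp only: vector_fields_def smooth_on_def mem_Collect_eq) blast
  then show "smooth_on ?S (local_rep \<A> c (\<lambda>q. (-1) *\<^sub>R Y q))"
  proof (rule smooth_on_cong[OF op, rotated])
    show "(-1) *\<^sub>R local_rep \<A> c Y y = local_rep \<A> c (\<lambda>q. (-1) *\<^sub>R Y q) y" if y: "y \<in> ?S" for y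
    proof -
      obtain q where "q \<in> fst c" "y = snd c q" using y by blast
      then show ?thesis
        using linear_scale[OF linear_components_in[OF c], of q "-1" "Y q"] by (simp add: local_rep_chart c)
    qed
  qed
qed

lemma const_smooth_function: "openin M V \<Longrightarrow> (\<lambda>q. r) \<in> smooth_functions \<A> V"
  unfolding smooth_functions_def smooth_on_def by (auto simp: o_def intro: Ck_on_const open_chart_image)

lemma dir_deriv_const: "dir_deriv \<A> X (\<lambda>q. r) p = 0"
  by (simp add: dir_deriv_def o_def)

lemma dir_deriv_cong:
  assumes "openin M V" "p \<in> V" "f \<in> smooth_functions \<A> V" "\<And>q. q \<in> V \<Longrightarrow> f q = g q"
  shows "dir_deriv \<A> X f p = dir_deriv \<A> X g p"
proof -
  let ?c = "chart_at \<A> p"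
  have p: "p \<in> topspace M" using assms openin_subset by blast
  note c = chart_at[OF p]
  have "frechet_derivative (f \<circ> chart_inv ?c) (at (snd ?c p)) =
      frechet_derivative (g \<circ> chart_inv ?c) (at (snd ?c p))"
  proof (rule frechet_derivative_transform_within_open)
    have "smooth_on (snd ?c ` (fst ?c \<inter> V)) (f \<circ> chart_inv ?c)"
      using assms c by (simp add: smooth_functions_def)
    then show "f \<circ> chart_inv ?c differentiable at (snd ?c p)"
      using smooth_on_has_derivative c assms(2) by (metis IntI differentiableI image_eqI)
    show "open (snd ?c ` (fst ?c \<inter> V))" using open_chart_image c assms by blast
  qed (use assms c in auto)
  then show ?thesis by (simp add: dir_deriv_def)
qed

section \<open>Extension of tangent vectors to global vector fields\<close>

lemma closedin_chart_inv:
  assumes c: "c \<in> \<A>" and K: "compact K" "K \<subseteq> snd c ` fst c"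
  shows "closedin M (chart_inv c ` K)"
proof -
  have sub: "chart_inv c ` K \<subseteq> fst c" using K(2) c by auto
  have im: "snd c ` (chart_inv c ` K) = K" using K(2) c by (force simp: image_image)
  have "compactin (top_of_set (snd c ` fst c)) (snd c ` (chart_inv c ` K))"
    using K by (simp add: im compactin_subtopology)
  then have "compactin (subtopology M (fst c)) (chart_inv c ` K)"
    using homeomorphic_map_compactness[OF chart_homeo[OF c]] sub chart_subset[OF c]
    by (metis topspace_subtopology_subset)
  then have "compactin M (chart_inv c ` K)" by (simp add: compactin_subtopology)
  then show ?thesis
    using compactin_imp_closedin smooth by (auto simp: smooth_manifold_def)
qed

text \<open>The field with constant components \<open>w\<close> in the chart at \<open>p\<close> is
  multiplied by a bump function and extended by 0. The bump function is returned as well, because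
  differentiating an endomorphism field later requires dividing by it near \<open>p\<close>.\<close>

lemma global_vector_field:
  fixes w :: 'e
  assumes p: "p \<in> topspace M"
  obtains X \<phi> where "X \<in> vector_fields \<A> (topspace M)" "X p = w"
    "\<phi> (snd (chart_at \<A> p) p) = 1" "smooth_on UNIV \<phi>"
    "\<And>y. y \<in> snd (chart_at \<A> p) ` fst (chart_at \<A> p) \<Longrightarrow>
       local_rep \<A> (chart_at \<A> p) X y = \<phi> y *\<^sub>R w"
proof -
  let ?c = "chart_at \<A> p"
  note c = chart_at[OF p]
  have "open (snd ?c ` fst ?c)" using is_chart[OF c(1)] by (simp add: is_chart_def)
  then obtain r where r: "r > 0" "cball (snd ?c p) r \<subseteq> snd ?c ` fst ?c"
    using c(2) open_contains_cball by (metis imageI)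
  obtain \<phi> :: "'e \<Rightarrow> real" where \<phi>: "smooth_on UNIV \<phi>" "\<phi> (snd ?c p) = 1"
    "\<And>y. y \<notin> cball (snd ?c p) r \<Longrightarrow> \<phi> y = 0"
    by (rule smooth_bump[OF r(1), of "snd ?c p"]) blast
  \<comment> \<open>The components \<open>w\<close> refer to the chart at \<open>p\<close>;
    \<open>transition_deriv\<close> converts them to the chart that identifies the tangent space at
    \<open>q\<close> with the model space.\<close>
  define X where "X q = (if q \<in> fst ?c then \<phi> (snd ?c q) *\<^sub>R transition_deriv ?c (chart_at \<A> q) q w else 0)" for q
  have rep: "local_rep \<A> d X (snd d q) = \<phi> (snd ?c q) *\<^sub>R transition_deriv ?c d q w"
    if d: "d \<in> \<A>" and q: "q \<in> fst d" "q \<in> fst ?c" for d q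
  proof -
    have "q \<in> topspace M" using q(1) chart_subset[OF d] by blast
    note cq = chart_at[OF this]
    show ?thesis
      using linear_scale[OF linear_components_in[OF d q(1)]]
        transition_deriv_trans[OF c(1) cq(1) d q(2) cq(2) q(1)] q
      by (simp add: local_rep_chart[OF d q(1)] X_def components_in_eq)
  qed
  let ?K = "cball (snd ?c p) r"
  have "smooth_on (snd d ` (fst d \<inter> topspace M)) (local_rep \<A> d X)" if d: "d \<in> \<A>" for d
  proof -
    \<comment> \<open>\<open>chart_inv ?c\<close> applied to the ball \<open>?K\<close> gives a
      compact, hence closed, subset of the Hausdorff space \<open>M\<close> off which the field
      vanishes. Its complement \<open>?W\<close> and the chart domain at \<open>p\<close> are open
      and cover \<open>M\<close>; smoothness is checked on each by the explicit formula and by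
      vanishing.\<close>
    let ?S1 = "snd d ` (fst d \<inter> fst ?c)" and ?W = "topspace M - chart_inv ?c ` ?K"
    let ?S2 = "snd d ` (fst d \<inter> ?W)" and ?T = "snd ?c ` (fst ?c \<inter> fst d)"
    have W: "openin M ?W" using closedin_chart_inv[OF c(1) compact_cball r(2)] by blast
    have S1: "open ?S1" and S2: "open ?S2" and T: "open ?T"
      using open_chart_image d c(1) openin_chart W by blast+
    have tr: "smooth_on ?S1 (snd ?c \<circ> chart_inv d)" by (rule smooth_transition[OF d c(1)])
    have "smooth_on ?S1 (\<lambda>y. \<phi> ((snd ?c \<circ> chart_inv d) y) *\<^sub>R
        frechet_derivative (snd d \<circ> chart_inv ?c) (at ((snd ?c \<circ> chart_inv d) y)) w)"
    proof (rule smooth_on_scaleR[OF S1])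
      show "smooth_on ?S1 (\<lambda>y. \<phi> ((snd ?c \<circ> chart_inv d) y))"
        by (rule smooth_on_compose[OF S1 open_UNIV subset_UNIV tr \<phi>(1)])
      show "smooth_on ?S1 (\<lambda>y. frechet_derivative (snd d \<circ> chart_inv ?c) (at ((snd ?c \<circ> chart_inv d) y)) w)"
        by (rule smooth_on_compose[OF S1 T _ tr
              smooth_on_frechet_derivative[OF smooth_transition[OF c(1) d]]]) (use d in auto)
    qed
    then have 1: "smooth_on ?S1 (local_rep \<A> d X)"
      by (rule smooth_on_cong[OF S1, rotated]) (use d rep[OF d] in \<open>auto simp: transition_deriv_def\<close>)
    have "smooth_on ?S2 (\<lambda>y. 0 :: 'e)" by (simp add: smooth_on_def Ck_on_const[OF S2])
    then have 2: "smooth_on ?S2 (local_rep \<A> d X)"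
    proof (rule smooth_on_cong[OF S2, rotated])
      fix y assume "y \<in> ?S2"
      then obtain q where q: "q \<in> fst d" "q \<notin> chart_inv ?c ` ?K" "y = snd d q" by blast
      have "X q = 0"
      proof (cases "q \<in> fst ?c")
        case True
        then have "snd ?c q \<notin> ?K" using q(2) c(1) by (metis chart_inv imageI)
        then show ?thesis using \<phi>(3) by (simp add: X_def)
      qed (simp add: X_def)
      then show "0 = local_rep \<A> d X y"
        using linear_0[OF linear_components_in[OF d q(1)]] q by (simp add: local_rep_chart d)
    qed
    have "chart_inv ?c ` ?K \<subseteq> fst ?c" using r(2) c(1) by auto
    then have "fst d \<inter> topspace M \<subseteq> (fst d \<inter> fst ?c) \<union> (fst d \<inter> ?W)" by blast
    then have "snd d ` (fst d \<inter> topspace M) \<subseteq> ?S1 \<union> ?S2" by (metis image_Un image_mono)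
    moreover have "smooth_on (?S1 \<union> ?S2) (local_rep \<A> d X)"
      using 1 2 by (simp add: smooth_on_def Ck_on_Un[OF S1 S2])
    ultimately show ?thesis by (rule smooth_on_subset[rotated])
  qed
  then have vf: "X \<in> vector_fields \<A> (topspace M)" by (simp add: vector_fields_def)
  have loc: "local_rep \<A> ?c X y = \<phi> y *\<^sub>R w" if "y \<in> snd ?c ` fst ?c" for y
    using that rep[OF c(1)] transition_deriv_self[OF c(1)] by auto
  have "X p = w"
    using loc[of "snd ?c p"] c components_in_self[OF p] \<phi>(2) by (simp add: local_rep_chart)
  then show thesis using that vf \<phi>(1,2) loc by blast
qed

end

section \<open>Traces\<close>

lemma endo_trace_add: "endo_trace (\<lambda>v. f v + g v) = endo_trace f + endo_trace g"
  by (simp add: endo_trace_def inner_add_left sum.distrib)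

lemma endo_trace_diff: "endo_trace (\<lambda>v. f v - g v) = endo_trace f - endo_trace g"
  by (simp add: endo_trace_def inner_diff_left sum_subtractf)

lemma endo_trace_minus: "endo_trace (\<lambda>v. - f v) = - endo_trace f"
  by (simp add: endo_trace_def sum_negf)

lemma endo_trace_scaleR: "endo_trace (\<lambda>v. r *\<^sub>R f v) = r * endo_trace f"
  by (simp add: endo_trace_def sum_distrib_left)

lemma endo_trace_ident: "endo_trace (\<lambda>v::'e::euclidean_space. v) = real DIM('e)"
  by (simp add: endo_trace_def)

lemma endo_trace_rank_one:
  fixes w :: "'e::euclidean_space"
  assumes "linear \<phi>"
  shows "endo_trace (\<lambda>v. \<phi> v *\<^sub>R w) = \<phi> w"
proof -
  have "\<phi> w = \<phi> (\<Sum>i\<in>Basis. (w \<bullet> i) *\<^sub>R i)" by (simp add: euclidean_representation)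
  also have "\<dots> = (\<Sum>i\<in>Basis. (w \<bullet> i) * \<phi> i)" using assms by (simp add: linear_sum linear_scale)
  finally show ?thesis by (simp add: endo_trace_def mult.commute)
qed

text \<open>Both traces are the same double sum over matrix entries, taken in opposite
  orders.\<close>

lemma endo_trace_commute:
  fixes f g :: "'e::euclidean_space \<Rightarrow> 'e"
  assumes "linear f" "linear g"
  shows "endo_trace (\<lambda>v. f (g v)) = endo_trace (\<lambda>v. g (f v))"
proof -
  have exp: "endo_trace (\<lambda>v. h (k v)) = (\<Sum>i\<in>Basis. \<Sum>j\<in>Basis. (k i \<bullet> j) * (h j \<bullet> i))"
    if "linear h" for h k :: "'e \<Rightarrow> 'e"
  proof -
    have "h (k i) = (\<Sum>j\<in>Basis. (k i \<bullet> j) *\<^sub>R h j)" for i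
    proof -
      have "h (k i) = h (\<Sum>j\<in>Basis. (k i \<bullet> j) *\<^sub>R j)" by (simp add: euclidean_representation)
      then show ?thesis using that by (simp add: linear_sum linear_scale)
    qed
    then show ?thesis by (simp add: endo_trace_def inner_sum_left)
  qed
  have "endo_trace (\<lambda>v. f (g v)) = (\<Sum>j\<in>Basis. \<Sum>i\<in>Basis. (g i \<bullet> j) * (f j \<bullet> i))"
    unfolding exp[OF assms(1)] by (rule sum.swap)
  then show ?thesis unfolding exp[OF assms(2)] by (simp add: mult.commute)
qed

section \<open>Quaternionic linear algebra\<close>

text \<open>Stands for \<open>J a p\<close>, \<open>J b p\<close>, \<open>J c p\<close> with cyclic
  \<open>(a, b, c)\<close>, so that the three cyclic cases are treated at once. The full
  multiplication table is assumed as rewrite rules, which reduce every word in the three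
  structures.\<close>

locale quaternionic_triple =
  fixes I J K :: "'e::euclidean_space \<Rightarrow> 'e"
  assumes linI: "linear I" and linJ: "linear J" and linK: "linear K"
    and II [simp]: "I (I v) = - v" and JJ [simp]: "J (J v) = - v" and KK [simp]: "K (K v) = - v"
    and IJ [simp]: "I (J v) = K v" and JI [simp]: "J (I v) = - K v"
    and JK [simp]: "J (K v) = I v" and KJ [simp]: "K (J v) = - I v"
    and KI [simp]: "K (I v) = J v" and IK [simp]: "I (K v) = - J v"
begin

lemmas lin_simps = linear_add[OF linI] linear_add[OF linJ] linear_add[OF linK]
  linear_diff[OF linI] linear_diff[OF linJ] linear_diff[OF linK]
  linear_neg[OF linI] linear_neg[OF linJ] linear_neg[OF linK]
  linear_scale[OF linI] linear_scale[OF linJ] linear_scale[OF linK]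

text \<open>Each structure is a product of the other two, and exchanging the factors changes its
  sign but not the trace.\<close>

lemma trace_I: "endo_trace I = 0" and trace_J: "endo_trace J = 0" and trace_K: "endo_trace K = 0"
proof -
  have "endo_trace I = endo_trace (\<lambda>v. - I v)" using endo_trace_commute[OF linJ linK] by simp
  then show "endo_trace I = 0" by (simp add: endo_trace_minus)
  have "endo_trace J = endo_trace (\<lambda>v. - J v)" using endo_trace_commute[OF linK linI] by simp
  then show "endo_trace J = 0" by (simp add: endo_trace_minus)
  have "endo_trace K = endo_trace (\<lambda>v. - K v)" using endo_trace_commute[OF linI linJ] by simp
  then show "endo_trace K = 0" by (simp add: endo_trace_minus)
qed

text \<open>This is 4 \<pi> for the complex structure \<open>I\<close> at a single point.\<close>

definition proj4 :: "('e \<Rightarrow> 'e \<Rightarrow> 'e) \<Rightarrow> 'e \<Rightarrow> 'e \<Rightarrow> 'e" where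
  "proj4 \<phi> u v = \<phi> u v + I (\<phi> (I u) v + \<phi> u (I v)) - \<phi> (I u) (I v)"

text \<open>The left-hand side of the second condition of the theorem at a point, with
  \<open>I\<close>, \<open>J\<close>, \<open>K\<close> for the structures of index a, b, c.\<close>

definition antisym_form :: "('e \<Rightarrow> real) \<Rightarrow> 'e \<Rightarrow> 'e \<Rightarrow> 'e" where
  "antisym_form \<psi> u v = \<psi> u *\<^sub>R J v + \<psi> (I u) *\<^sub>R K v - \<psi> v *\<^sub>R J u - \<psi> (I v) *\<^sub>R K u"

text \<open>Cyclicity of the trace moves an \<open>I\<close> in the second slot of \<phi> to the
  front, where it merges with \<open>J\<close> or \<open>K\<close>. The four terms then coincide in
  pairs.\<close>

lemma trace_proj4:
  assumes "bilinear \<phi>"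
  shows "endo_trace (\<lambda>v. J (proj4 \<phi> u v)) =
    2 * (endo_trace (\<lambda>v. J (\<phi> u v)) - endo_trace (\<lambda>v. K (\<phi> (I u) v)))"
proof -
  have lin: "linear (\<phi> u)" for u using assms by (simp add: bilinear_def)
  have 1: "endo_trace (\<lambda>v. K (\<phi> u (I v))) = - endo_trace (\<lambda>v. J (\<phi> u v))" for u
    using endo_trace_commute[OF linear_compose[OF lin linK, unfolded o_def] linI, of u]
    by (simp add: endo_trace_minus)
  have 2: "endo_trace (\<lambda>v. J (\<phi> u (I v))) = endo_trace (\<lambda>v. K (\<phi> u v))" for u
    using endo_trace_commute[OF linear_compose[OF lin linJ, unfolded o_def] linI, of u] by simp
  show ?thesis
    by (simp add: proj4_def lin_simps endo_trace_diff endo_trace_add endo_trace_minus 1 2)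
qed

text \<open>After applying \<open>J\<close>, the four terms are a multiple of the identity,
  contributing the dimension, a multiple of \<open>I\<close>, which is traceless, and two maps of
  rank one with trace \<open>\<psi> u\<close> each.\<close>

lemma trace_antisym_form:
  assumes "linear \<psi>"
  shows "endo_trace (\<lambda>v. J (antisym_form \<psi> u v)) = - (real DIM('e) - 2) * \<psi> u"
proof -
  have lin: "linear (\<lambda>v. \<psi> (I v))" using linear_compose[OF linI assms] by (simp add: o_def)
  show ?thesis
    by (simp add: antisym_form_def lin_simps endo_trace_diff endo_trace_add endo_trace_minus
        endo_trace_scaleR endo_trace_rank_one[OF assms] endo_trace_rank_one[OF lin] trace_I
        endo_trace_ident linear_neg[OF assms] algebra_simps)
qed

text \<open>For \<open>r = 4 * n - 2\<close> and \<phi> the Obata torsion at a point, this is the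
  torsion of the unimodular Oproiu connection there; the coefficients of \<open>L v\<close> and
  \<open>L u\<close> are the values of the form \<tau> belonging to \<open>L\<close>.\<close>

definition normalised :: "real \<Rightarrow> ('e \<Rightarrow> 'e \<Rightarrow> 'e) \<Rightarrow> 'e \<Rightarrow> 'e \<Rightarrow> 'e" where
  "normalised r \<phi> u v = \<phi> u v + (\<Sum>L\<leftarrow>[I, J, K].
     (1 / r * endo_trace (\<lambda>w. L (\<phi> u w))) *\<^sub>R L v - (1 / r * endo_trace (\<lambda>w. L (\<phi> v w))) *\<^sub>R L u)"

lemma linear_trace:
  assumes "bilinear \<phi>" "linear L"
  shows "linear (\<lambda>u. 1 / r * endo_trace (\<lambda>w. L (\<phi> u w)))"
proof (rule linearI)
  show "1 / r * endo_trace (\<lambda>w. L (\<phi> (u + v) w)) =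
      1 / r * endo_trace (\<lambda>w. L (\<phi> u w)) + 1 / r * endo_trace (\<lambda>w. L (\<phi> v w))" for u v
    using assms by (simp add: bilinear_ladd linear_add endo_trace_add distrib_left add_divide_distrib)
  show "1 / r * endo_trace (\<lambda>w. L (\<phi> (c *\<^sub>R u) w)) = c *\<^sub>R (1 / r * endo_trace (\<lambda>w. L (\<phi> u w)))" for c u
    using assms by (simp add: bilinear_lmul linear_scale endo_trace_scaleR)
qed

lemma bilinear_form_endo:
  assumes "linear f" "linear L"
  shows "bilinear (\<lambda>u v. f u *\<^sub>R L v - f v *\<^sub>R L u)"
  unfolding bilinear_def
  by (auto intro!: linearI simp: linear_add[OF assms(1)] linear_add[OF assms(2)]
      linear_scale[OF assms(1)] linear_scale[OF assms(2)] algebra_simps)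

lemma bilinear_plus: "bilinear f \<Longrightarrow> bilinear g \<Longrightarrow> bilinear (\<lambda>u v. f u v + g u v)"
  unfolding bilinear_def by (auto intro: linear_compose_add)

lemma bilinear_normalised:
  assumes "bilinear \<phi>"
  shows "bilinear (normalised r \<phi>)"
  unfolding normalised_def
  by (simp only: list.map sum_list.Cons sum_list.Nil add_0_right,
      intro bilinear_plus bilinear_form_endo linear_trace assms linI linJ linK)

text \<open>By \<open>trace_proj4\<close> the traces of \<open>J\<close> with the map at
  \<open>u\<close> and of \<open>K\<close> with the map at \<open>I u\<close> must agree. Both equal
  \<open>t I (K u) - t J u - t K (I u)\<close>. The choice of \<open>r\<close> as the dimension
  minus 2 gives \<open>t J u\<close> and \<open>t K (I u)\<close> the same coefficient -1 in
  both.\<close>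

lemma trace_proj4_normalised:
  assumes "bilinear \<phi>" "r = real DIM('e) - 2" "r \<noteq> 0"
  shows "endo_trace (\<lambda>v. J (proj4 (normalised r \<phi>) u v)) = 0"
proof -
  define t where "t L u = 1 / r * endo_trace (\<lambda>w. L (\<phi> u w))" for L u
  have lin: "linear (t I)" "linear (t J)" "linear (t K)"
    unfolding t_def by (rule linear_trace[OF assms(1)], rule linI linJ linK)+
  have n: "normalised r \<phi> u v = \<phi> u v + (t I u *\<^sub>R I v - t I v *\<^sub>R I u)
      + (t J u *\<^sub>R J v - t J v *\<^sub>R J u) + (t K u *\<^sub>R K v - t K v *\<^sub>R K u)" for u v
    by (simp add: normalised_def t_def)
  have r: "endo_trace (\<lambda>w. L (\<phi> u w)) = r * t L u" for L u
    using assms(3) by (simp add: t_def)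
  have d: "real DIM('e) = r + 2" using assms(2) by simp
  have J: "endo_trace (\<lambda>v. J (normalised r \<phi> u v)) = r * t J u - t J u * (r + 2) + t J u - t I (- K u) - t K (I u)" for u
    by (simp add: n lin_simps endo_trace_diff endo_trace_add endo_trace_minus endo_trace_scaleR
        endo_trace_rank_one lin trace_I trace_K endo_trace_ident d r linear_neg[OF lin(1)] linear_neg[OF lin(2)])
  have K: "endo_trace (\<lambda>v. K (normalised r \<phi> u v)) = r * t K u - t K u * (r + 2) + t K u - t I (J u) + t J (I u)" for u
    by (simp add: n lin_simps endo_trace_diff endo_trace_add endo_trace_minus endo_trace_scaleR
        endo_trace_rank_one lin trace_I trace_J endo_trace_ident d r linear_neg[OF lin(3)] linear_neg[OF lin(2)])
  show ?thesis
    by (simp add: trace_proj4[OF bilinear_normalised[OF assms(1)]] J K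
        linear_neg[OF lin(1)] linear_neg[OF lin(2)] linear_neg[OF lin(3)] algebra_simps)
qed

text \<open>Composing with \<open>J\<close> and taking the trace kills the \<open>proj4\<close> term
  and leaves \<open>- r * \<psi> u\<close>.\<close>

lemma form_eq_0:
  assumes "bilinear \<phi>" "r = real DIM('e) - 2" "r \<noteq> 0" "linear \<psi>"
    and "\<And>u v. proj4 (normalised r \<phi>) u v + antisym_form \<psi> u v = 0"
  shows "\<psi> u = 0"
proof -
  have "J (proj4 (normalised r \<phi>) u v) + J (antisym_form \<psi> u v) = 0" for v
    using assms(5)[of u v] by (metis linear_add linear_0 linJ)
  then have "endo_trace (\<lambda>v. J (proj4 (normalised r \<phi>) u v))
      + endo_trace (\<lambda>v. J (antisym_form \<psi> u v)) = endo_trace (\<lambda>v::'e. 0)"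
    by (simp flip: endo_trace_add)
  then show ?thesis
    using trace_proj4_normalised[OF assms(1-3)] trace_antisym_form[OF assms(4)] assms(2,3)
    by (simp add: endo_trace_def)
qed

end

section \<open>The Nijenhuis tensor at a point\<close>

lemma app_field_apply: "app_field S X p = S p (X p)"
  by (simp add: app_field_def)

context manifold
begin

lemma app_field_vector_field:
  assumes "openin M U" "smooth_endo_field M \<A> U S" "openin M V" "X \<in> vector_fields \<A> V"
  shows "app_field S X \<in> vector_fields \<A> (V \<inter> U)"
  using assms vector_fields_mono[OF assms(4), of "V \<inter> U"]
  unfolding smooth_endo_field_def by (metis inf_le1 inf_le2 openin_Int)

text \<open>Leibniz rule for \<open>S X\<close> in the chart at \<open>p\<close>; \<open>S'\<close> is the derivative of the matrix of \<open>S\<close>.\<close>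

lemma endo_field_derivative:
  assumes U: "openin M U" "smooth_endo_field M \<A> U S" and p: "p \<in> U"
  obtains S' where "bilinear S'"
    "\<And>V X u. openin M V \<Longrightarrow> p \<in> V \<Longrightarrow> X \<in> vector_fields \<A> V \<Longrightarrow>
      frechet_derivative (local_rep \<A> (chart_at \<A> p) (app_field S X)) (at (snd (chart_at \<A> p) p)) u =
      S p (frechet_derivative (local_rep \<A> (chart_at \<A> p) X) (at (snd (chart_at \<A> p) p)) u) + S' u (X p)"
proof -
  let ?c = "chart_at \<A> p"
  let ?p = "snd ?c p" and ?I = "snd ?c ` fst ?c"
  have pM: "p \<in> topspace M" using U p openin_subset by blast
  note c = chart_at[OF pM]
  have I: "open ?I" using is_chart[OF c(1)] by (simp add: is_chart_def)
  have pI: "?p \<in> ?I" using c by simp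
  \<comment> \<open>The matrix of \<open>S\<close> in the fixed chart \<open>?c\<close>: components
    are converted to the chart at the point, \<open>S\<close> is applied, and the result is
    converted back.\<close>
  define j where "j y w = components_in \<A> ?c (chart_inv ?c y)
    (S (chart_inv ?c y) (transition_deriv ?c (chart_at \<A> (chart_inv ?c y)) (chart_inv ?c y) w))" for y w
  have j_rep: "local_rep \<A> ?c (app_field S X) y = j y (local_rep \<A> ?c X y)" if y: "y \<in> ?I" for X y
  proof -
    obtain q where q: "q \<in> fst ?c" "y = snd ?c q" using y by blast
    have "q \<in> topspace M" using q(1) chart_subset[OF c(1)] by blast
    note cq = chart_at[OF this]
    show ?thesis
      using transition_deriv_trans[OF cq(1) c(1) cq(1) cq(2) q(1) cq(2)] transition_deriv_self[OF cq]
      by (simp add: q(2) local_rep_chart[OF c(1) q(1)] j_def c(1) q(1) app_field_def components_in_eq)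
  qed
  have j_lin: "linear (j y)" if y: "y \<in> ?I" for y
  proof -
    obtain q where q: "q \<in> fst ?c" "y = snd ?c q" using y by blast
    have "q \<in> topspace M" using q(1) chart_subset[OF c(1)] by blast
    note cq = chart_at[OF this]
    have "linear (components_in \<A> ?c q \<circ> (S q \<circ> transition_deriv ?c (chart_at \<A> q) q))"
      by (intro linear_compose linear_components_in linear_transition_deriv c cq q(1)
          bounded_linear.linear blinfun.bounded_linear_right)
    then show ?thesis using q c(1) by (simp add: j_def[abs_def] o_def)
  qed
  have j_p: "j ?p w = S p w" for w
    using transition_deriv_self[OF c] components_in_self[OF pM] c by (simp add: j_def)
  \<comment> \<open>Smoothness of \<open>S\<close> is known only through its action on vector
    fields. So \<open>S\<close> is applied to a global field with components
    \<open>\<phi> y *\<^sub>R w\<close>, and the result is divided by \<phi> where this is nonzero,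
    which includes a neighbourhood of \<open>?p\<close>.\<close>
  have j_diff: "((\<lambda>y. j y w) has_derivative frechet_derivative (\<lambda>y. j y w) (at ?p)) (at ?p)" for w
  proof -
    obtain X \<phi> where X: "X \<in> vector_fields \<A> (topspace M)" "\<phi> ?p = 1" "smooth_on UNIV \<phi>"
      "\<And>y. y \<in> ?I \<Longrightarrow> local_rep \<A> ?c X y = \<phi> y *\<^sub>R w"
      by (rule global_vector_field[OF pM, of w]) blast
    have "app_field S X \<in> vector_fields \<A> (topspace M \<inter> U)"
      by (rule app_field_vector_field[OF U _ X(1)]) simp
    then have 1: "(local_rep \<A> ?c (app_field S X) has_derivative
        frechet_derivative (local_rep \<A> ?c (app_field S X)) (at ?p)) (at ?p)"
      by (rule vector_field_has_derivative[OF _ c(1)]) (use c pM p in simp)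
    have 2: "(\<phi> has_derivative frechet_derivative \<phi> (at ?p)) (at ?p)"
      by (rule smooth_on_has_derivative[OF X(3)]) simp
    have "continuous_on UNIV \<phi>" using X(3) unfolding smooth_on_def by (metis Ck_on.simps(1))
    then have ne: "open {y. \<phi> y \<noteq> 0}" by (intro open_Collect_neq) auto
    obtain g where "((\<lambda>y. inverse (\<phi> y) *\<^sub>R local_rep \<A> ?c (app_field S X) y) has_derivative g) (at ?p)"
      using has_derivative_scaleR[OF Deriv.has_derivative_inverse[OF _ 2] 1] X(2) by auto
    then have "((\<lambda>y. j y w) has_derivative g) (at ?p)"
    proof (rule has_derivative_transform_within_open)
      show "open ({y. \<phi> y \<noteq> 0} \<inter> ?I)" using ne I by blast
      show "inverse (\<phi> y) *\<^sub>R local_rep \<A> ?c (app_field S X) y = j y w"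
        if "y \<in> {y. \<phi> y \<noteq> 0} \<inter> ?I" for y
        using that by (simp add: j_rep X(4) linear_scale[OF j_lin])
    qed (use X(2) pI in auto)
    then show ?thesis using frechet_derivative_works differentiableI by blast
  qed
  define S' where "S' u v = (\<Sum>i\<in>Basis. (v \<bullet> i) *\<^sub>R frechet_derivative (\<lambda>y. j y i) (at ?p) u)" for u v
  have "bilinear S'"
  proof -
    have "linear (S' u)" for u
      by (auto intro!: linearI simp: S'_def inner_add_left scaleR_left_distrib sum.distrib scaleR_sum_right)
    moreover have "linear (\<lambda>u. S' u v)" for v
      unfolding S'_def
      by (intro linear_compose_sum ballI linear_compose_scale_right has_derivative_linear[OF j_diff])
    ultimately show ?thesis by (simp add: bilinear_def)
  qed
  moreover have "frechet_derivative (local_rep \<A> ?c (app_field S X)) (at ?p) u =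
      S p (frechet_derivative (local_rep \<A> ?c X) (at ?p) u) + S' u (X p)"
    if V: "openin M V" "p \<in> V" "X \<in> vector_fields \<A> V" for V X u
  proof -
    let ?x' = "frechet_derivative (local_rep \<A> ?c X) (at ?p)"
    have x: "(local_rep \<A> ?c X has_derivative ?x') (at ?p)"
      by (rule vector_field_has_derivative[OF V(3) c(1)]) (use V c in simp)
    have xp: "local_rep \<A> ?c X ?p = X p"
      by (simp add: local_rep_chart c components_in_self[OF pM])
    have exp: "j y w = (\<Sum>i\<in>Basis. (w \<bullet> i) *\<^sub>R j y i)" if "y \<in> ?I" for y w
    proof -
      have "j y w = j y (\<Sum>i\<in>Basis. (w \<bullet> i) *\<^sub>R i)" by (simp add: euclidean_representation)
      then show ?thesis using j_lin[OF that] by (simp add: linear_sum linear_scale)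
    qed
    have "((\<lambda>y. \<Sum>i\<in>Basis. (local_rep \<A> ?c X y \<bullet> i) *\<^sub>R j y i) has_derivative
        (\<lambda>u. \<Sum>i\<in>Basis. (local_rep \<A> ?c X ?p \<bullet> i) *\<^sub>R frechet_derivative (\<lambda>y. j y i) (at ?p) u
          + (?x' u \<bullet> i) *\<^sub>R j ?p i)) (at ?p)"
      by (intro has_derivative_sum has_derivative_scaleR has_derivative_inner_left x j_diff)
    then have d: "(local_rep \<A> ?c (app_field S X) has_derivative
        (\<lambda>u. \<Sum>i\<in>Basis. (local_rep \<A> ?c X ?p \<bullet> i) *\<^sub>R frechet_derivative (\<lambda>y. j y i) (at ?p) u
          + (?x' u \<bullet> i) *\<^sub>R j ?p i)) (at ?p)"
    proof (rule has_derivative_transform_within_open[OF _ I pI])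
      show "(\<Sum>i\<in>Basis. (local_rep \<A> ?c X y \<bullet> i) *\<^sub>R j y i) = local_rep \<A> ?c (app_field S X) y"
        if "y \<in> ?I" for y
        unfolding j_rep[OF that] by (rule exp[OF that, symmetric])
    qed
    have "frechet_derivative (local_rep \<A> ?c (app_field S X)) (at ?p) u =
        (\<Sum>i\<in>Basis. (X p \<bullet> i) *\<^sub>R frechet_derivative (\<lambda>y. j y i) (at ?p) u
          + (?x' u \<bullet> i) *\<^sub>R j ?p i)"
      unfolding frechet_derivative_at[OF d, symmetric] xp by (rule refl)
    then show ?thesis
      by (simp add: sum.distrib S'_def j_p exp[OF pI, of "?x' u", unfolded j_p])
  qed
  ultimately show thesis using that by blast
qed

text \<open>In the chart at \<open>p\<close> all derivatives of \<open>X\<close> and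
  \<open>Y\<close> cancel because \<open>S\<close> squares to -1. What remains involves only
  \<open>S\<close> and its derivative \<open>S'\<close>, so the bilinear map \<open>B\<close> is the
  same for all neighbourhoods \<open>V\<close>.\<close>

lemma nijenhuis_tensor:
  assumes U: "openin M U" "smooth_endo_field M \<A> U S" and p: "p \<in> U"
    and sq: "\<And>v. S p (S p v) = - v"
  obtains B where "bilinear B"
    "\<And>V X Y. openin M V \<Longrightarrow> p \<in> V \<Longrightarrow> X \<in> vector_fields \<A> V \<Longrightarrow> Y \<in> vector_fields \<A> V \<Longrightarrow>
      nijenhuis \<A> S X Y p = B (X p) (Y p)"
proof -
  obtain S' where S': "bilinear S'"
    "\<And>V X u. openin M V \<Longrightarrow> p \<in> V \<Longrightarrow> X \<in> vector_fields \<A> V \<Longrightarrow>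
      frechet_derivative (local_rep \<A> (chart_at \<A> p) (app_field S X)) (at (snd (chart_at \<A> p) p)) u =
      S p (frechet_derivative (local_rep \<A> (chart_at \<A> p) X) (at (snd (chart_at \<A> p) p)) u) + S' u (X p)"
    by (rule endo_field_derivative[OF U p]) blast
  define B where "B u v = S' (S p u) v - S' (S p v) u + S p (S' v u) - S p (S' u v)" for u v
  have "bilinear B"
    unfolding bilinear_def B_def
    by (auto intro!: linearI simp: bilinear_ladd[OF S'(1)] bilinear_radd[OF S'(1)]
        bilinear_lmul[OF S'(1)] bilinear_rmul[OF S'(1)] blinfun.bilinear_simps algebra_simps)
  moreover have "nijenhuis \<A> S X Y p = B (X p) (Y p)"
    if "openin M V" "p \<in> V" "X \<in> vector_fields \<A> V" "Y \<in> vector_fields \<A> V" for V X Y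
    by (simp add: nijenhuis_def lie_bracket_def Let_def B_def app_field_apply
        S'(2)[OF that(1,2,3)] S'(2)[OF that(1,2,4)] blinfun.bilinear_simps sq algebra_simps)
  ultimately show thesis using that by blast
qed

end

section \<open>Admissible bases\<close>

lemma quaternionic_triple_rotate: "quaternionic_triple I J K \<Longrightarrow> quaternionic_triple J K I"
  by (simp add: quaternionic_triple_def)

text \<open>The products with the third structure follow from \<open>J 3 = J 1 J 2\<close> and
  \<open>J 3 = - J 2 J 1\<close>, whichever brings two equal factors together. The resulting table
  is invariant under cyclic rotation.\<close>

lemma admissible_basis_triple:
  assumes "admissible_basis M \<A> Q U J" "p \<in> U" "(a, b, c) \<in> cyclic_triples"
  shows "quaternionic_triple (blinfun_apply (J a p)) (blinfun_apply (J b p)) (blinfun_apply (J c p))"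
proof -
  have eqs: "J 1 p o\<^sub>L J 1 p = - id_blinfun" "J 2 p o\<^sub>L J 2 p = - id_blinfun"
    "J 3 p o\<^sub>L J 3 p = - id_blinfun" "J 1 p o\<^sub>L J 2 p = J 3 p" "J 2 p o\<^sub>L J 1 p = - J 3 p"
    using assms(1,2) by (auto simp: admissible_basis_def)
  have sq: "J 1 p (J 1 p v) = - v" "J 2 p (J 2 p v) = - v" "J 3 p (J 3 p v) = - v"
    and m: "J 1 p (J 2 p v) = J 3 p v" "J 2 p (J 1 p v) = - J 3 p v" for v
    using eqs[THEN arg_cong, of "\<lambda>f. blinfun_apply f v"] by (simp_all add: blinfun.bilinear_simps)
  have m': "J 3 p v = - J 2 p (J 1 p v)" for v using m(2) by simp
  have "J 2 p (J 3 p v) = J 1 p v" "J 3 p (J 1 p v) = J 2 p v" for v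
    by (simp_all add: m' sq blinfun.minus_right del: One_nat_def)
  moreover have "J 3 p (J 2 p v) = - J 1 p v" "J 1 p (J 3 p v) = - J 2 p v" for v
    by (simp_all add: sq blinfun.minus_right del: One_nat_def flip: m(1))
  ultimately have "quaternionic_triple (J 1 p) (J 2 p) (J 3 p)"
    using sq m by (simp add: quaternionic_triple_def bounded_linear.linear blinfun.bounded_linear_right
        del: One_nat_def)
  then show ?thesis
    using assms(3) quaternionic_triple_rotate by (auto simp: cyclic_triples_def)
qed

lemma cyclic_triples_set: "(a, b, c) \<in> cyclic_triples \<Longrightarrow> {a, b, c} = {1, 2, 3}"
  by (auto simp: cyclic_triples_def)

lemma cyclic_triples_sum:
  "(a, b, c) \<in> cyclic_triples \<Longrightarrow> (\<Sum>k\<in>{1,2,3}. f k) = f a + f b + (f c :: 'x::comm_monoid_add)"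
  by (auto simp: cyclic_triples_def ac_simps)

lemma admissible_basis_smooth:
  "admissible_basis M \<A> Q U J \<Longrightarrow> k \<in> {1,2,3} \<Longrightarrow> smooth_endo_field M \<A> U (J k)"
  by (auto simp: admissible_basis_def)

lemma admissible_basis_open: "admissible_basis M \<A> Q U J \<Longrightarrow> openin M U"
  by (simp add: admissible_basis_def)

lemma admissible_basis_app_field:
  assumes "admissible_basis M \<A> Q U J" "k \<in> {1,2,3}" "X \<in> vector_fields \<A> U"
  shows "app_field (J k) X \<in> vector_fields \<A> U"
  using admissible_basis_smooth[OF assms(1,2)] admissible_basis_open[OF assms(1)] assms(3)
  unfolding smooth_endo_field_def by blast

lemma in_span_three:
  assumes "x \<in> span {u, v, w}"
  obtains r s t where "x = r *\<^sub>R u + s *\<^sub>R v + t *\<^sub>R w"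
proof -
  obtain r where r: "x - r *\<^sub>R u \<in> span {v, w}" using assms by (auto simp: span_insert)
  then obtain s where s: "x - r *\<^sub>R u - s *\<^sub>R v \<in> span {w}" by (auto simp: span_insert)
  then obtain t where "x - r *\<^sub>R u - s *\<^sub>R v - t *\<^sub>R w \<in> span {}"
    using span_insert[of w "{}"] by auto
  then have "x = r *\<^sub>R u + s *\<^sub>R v + t *\<^sub>R w" by (simp add: algebra_simps)
  then show thesis by (rule that)
qed

context manifold
begin

lemma vector_field_at:
  assumes "openin M U" "p \<in> U"
  obtains X where "X \<in> vector_fields \<A> (topspace M)" "X \<in> vector_fields \<A> U" "X p = w"
proof -
  have p: "p \<in> topspace M" using assms openin_subset by blast
  obtain X where "X \<in> vector_fields \<A> (topspace M)" "X p = w"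
    by (rule global_vector_field[OF p, of w]) blast
  then show thesis using that vector_fields_mono openin_subset[OF assms(1)] by blast
qed

section \<open>The torsion of the connections\<close>

text \<open>A combination of Nijenhuis tensors is tensorial. The description in
  \<open>tensor_at\<close> has a unique solution because every pair of tangent vectors at
  \<open>p\<close> is attained by vector fields on \<open>U\<close>.\<close>

lemma obata_torsion_tensor:
  assumes J: "admissible_basis M \<A> Q U J" and p: "p \<in> U"
  obtains B where "bilinear B" "tensor_at M \<A> (obata_torsion \<A> J) p = B"
    "\<And>V X Y. openin M V \<Longrightarrow> p \<in> V \<Longrightarrow> X \<in> vector_fields \<A> V \<Longrightarrow> Y \<in> vector_fields \<A> V \<Longrightarrow>
      obata_torsion \<A> J X Y p = B (X p) (Y p)"
proof -
  note U = admissible_basis_open[OF J]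
  have "\<exists>B. bilinear B \<and> (\<forall>V X Y. openin M V \<longrightarrow> p \<in> V \<longrightarrow> X \<in> vector_fields \<A> V \<longrightarrow>
      Y \<in> vector_fields \<A> V \<longrightarrow> nijenhuis \<A> (J k) X Y p = B (X p) (Y p))" if k: "k \<in> {1,2,3}" for k
  proof -
    have "J k p (J k p v) = - v" for v
    proof -
      have "J k p o\<^sub>L J k p = - id_blinfun" using J p k unfolding admissible_basis_def by blast
      from arg_cong[OF this, of "\<lambda>f. blinfun_apply f v"] show ?thesis
        by (simp add: blinfun.bilinear_simps)
    qed
    from nijenhuis_tensor[OF U admissible_basis_smooth[OF J k] p this] show ?thesis by metis
  qed
  then obtain N where N: "\<And>k. k \<in> {1,2,3} \<Longrightarrow> bilinear (N k)"
    "\<And>k V X Y. k \<in> {1,2,3} \<Longrightarrow> openin M V \<Longrightarrow> p \<in> V \<Longrightarrow> X \<in> vector_fields \<A> V \<Longrightarrow>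
      Y \<in> vector_fields \<A> V \<Longrightarrow> nijenhuis \<A> (J k) X Y p = N k (X p) (Y p)"
    by metis
  define B where "B u v = (1/6) *\<^sub>R (\<Sum>k\<in>{1,2,3}. N k u v)" for u v
  have bil: "bilinear B"
  proof -
    have "linear (B u)" "linear (\<lambda>u. B u v)" for u v
      unfolding B_def using N(1)
      by (intro linear_compose_scale_right linear_compose_sum; auto simp: bilinear_def)+
    then show ?thesis by (simp add: bilinear_def)
  qed
  have eq: "obata_torsion \<A> J X Y p = B (X p) (Y p)"
    if "openin M V" "p \<in> V" "X \<in> vector_fields \<A> V" "Y \<in> vector_fields \<A> V" for V X Y
    by (simp add: obata_torsion_def B_def N(2)[OF _ that])
  have "tensor_at M \<A> (obata_torsion \<A> J) p u v = B u v" for u v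
    unfolding tensor_at_def
  proof (rule the_equality)
    show "\<forall>V X Y. openin M V \<and> p \<in> V \<and> X \<in> vector_fields \<A> V \<and> Y \<in> vector_fields \<A> V \<and>
        X p = u \<and> Y p = v \<longrightarrow> obata_torsion \<A> J X Y p = B u v"
      using eq by blast
  next
    fix w
    assume w: "\<forall>V X Y. openin M V \<and> p \<in> V \<and> X \<in> vector_fields \<A> V \<and> Y \<in> vector_fields \<A> V \<and>
        X p = u \<and> Y p = v \<longrightarrow> obata_torsion \<A> J X Y p = w"
    obtain X Y where "X \<in> vector_fields \<A> U" "X p = u" "Y \<in> vector_fields \<A> U" "Y p = v"
      using vector_field_at[OF U p] by metis
    then show "w = B u v" using w eq U p by metis
  qed
  then show thesis using that bil eq by blast
qed

text \<open>Here \<open>B\<close> is the Obata torsion at \<open>p\<close>; the sum over 1, 2, 3 is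
  reordered to run over \<open>a\<close>, \<open>b\<close>, \<open>c\<close>.\<close>

lemma unimodular_oproiu_torsion:
  assumes D: "unimodular_oproiu_connection M \<A> n Q \<omega> D"
    and J: "admissible_basis M \<A> Q U J" and p: "p \<in> U" and abc: "(a, b, c) \<in> cyclic_triples"
  obtains B where "bilinear B"
    "\<And>X Y. X \<in> vector_fields \<A> U \<Longrightarrow> Y \<in> vector_fields \<A> U \<Longrightarrow>
      torsion \<A> D X Y p =
      quaternionic_triple.normalised (J a p) (J b p) (J c p) (4 * real n - 2) B (X p) (Y p)"
proof -
  interpret quaternionic_triple "J a p" "J b p" "J c p"
    by (rule admissible_basis_triple[OF J p abc])
  obtain B where B: "bilinear B" "tensor_at M \<A> (obata_torsion \<A> J) p = B"
    "\<And>V X Y. openin M V \<Longrightarrow> p \<in> V \<Longrightarrow> X \<in> vector_fields \<A> V \<Longrightarrow> Y \<in> vector_fields \<A> V \<Longrightarrow>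
      obata_torsion \<A> J X Y p = B (X p) (Y p)"
    by (rule obata_torsion_tensor[OF J p]) blast
  note U = admissible_basis_open[OF J]
  have "torsion \<A> D X Y p = normalised (4 * real n - 2) B (X p) (Y p)"
    if X: "X \<in> vector_fields \<A> U" and Y: "Y \<in> vector_fields \<A> U" for X Y
  proof -
    have "torsion \<A> D X Y p = obata_torsion \<A> J X Y p
            + (\<Sum>a\<in>{1,2,3}. del_form_endo (obata_trace_form M \<A> n J a) (J a) X Y p)"
      using D J U X Y p unfolding unimodular_oproiu_connection_def by blast
    then show ?thesis
      unfolding cyclic_triples_sum[OF abc] B(3)[OF U p X Y]
      by (simp add: normalised_def del_form_endo_def obata_trace_form_def B(2))
  qed
  then show thesis using that B(1) by blast
qed

section \<open>The correction by \<omega> and its effect on the torsion\<close>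

lemma
  assumes D: "affine_connection M \<A> D" and V: "openin M V"
    and X: "X \<in> vector_fields \<A> V" and Y: "Y \<in> vector_fields \<A> V" and p: "p \<in> V"
  shows affine_connection_cong:
      "Y' \<in> vector_fields \<A> V \<Longrightarrow> (\<And>q. q \<in> V \<Longrightarrow> Y q = Y' q) \<Longrightarrow> D X Y p = D X Y' p"
    and affine_connection_Leibniz:
      "f \<in> smooth_functions \<A> V \<Longrightarrow>
        D X (\<lambda>q. f q *\<^sub>R Y q) p = dir_deriv \<A> X f p *\<^sub>R Y p + f p *\<^sub>R D X Y p"
proof -
  note conn = D[unfolded affine_connection_def, THEN spec, THEN mp, OF V, THEN bspec, OF X,
      THEN bspec, OF X, THEN bspec, OF Y, THEN bspec, THEN bspec]
  show "D X Y p = D X Y' p" if "Y' \<in> vector_fields \<A> V" "\<And>q. q \<in> V \<Longrightarrow> Y q = Y' q"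
    using conn[OF that(1) const_smooth_function[OF V, of 0], THEN conjunct2, THEN conjunct1] that(2) p
    by simp
  show "D X (\<lambda>q. f q *\<^sub>R Y q) p = dir_deriv \<A> X f p *\<^sub>R Y p + f p *\<^sub>R D X Y p"
    if "f \<in> smooth_functions \<A> V"
    using conn[OF Y that, THEN conjunct2, THEN conjunct2, THEN bspec, OF p] by blast
qed

text \<open>Since \<open>\<nabla>Q \<subseteq> Q\<close> and \<open>\<omega>\<close> is \<open>Q\<close>-Hermitian, so is \<open>\<nabla>\<^sub>X \<omega>\<close>.\<close>

lemma omega_correction_commutes:
  assumes qsH: "almost_qsH M \<A> Q \<omega>" and D: "unimodular_oproiu_connection M \<A> n Q \<omega> D"
    and A: "omega_correction M \<A> \<omega> D A"
    and J: "admissible_basis M \<A> Q U J" and p: "p \<in> U" and abc: "(a, b, c) \<in> cyclic_triples"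
    and X: "X \<in> vector_fields \<A> U" and Y: "Y \<in> vector_fields \<A> U"
  shows "A p (X p) (J a p (Y p)) = J a p (A p (X p) (Y p))"
proof -
  interpret quaternionic_triple "J a p" "J b p" "J c p"
    by (rule admissible_basis_triple[OF J p abc])
  note U = admissible_basis_open[OF J]
  have pM: "p \<in> topspace M" using U p openin_subset by blast
  have mem: "a \<in> {1,2,3}" "b \<in> {1,2,3}" "c \<in> {1,2,3}" using cyclic_triples_set[OF abc] by auto
  have Q: "Q q = span {J a q, J b q, J c q}" if "q \<in> U" for q
  proof -
    have "{J a q, J b q, J c q} = (\<lambda>k. J k q) ` {a, b, c}" by simp
    also have "\<dots> = {J 1 q, J 2 q, J 3 q}" unfolding cyclic_triples_set[OF abc] by simp
    finally show ?thesis using J that by (simp add: admissible_basis_def)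
  qed
  have conn: "affine_connection M \<A> D" and pres: "preserves_bundle M \<A> D Q"
    using D by (simp_all add: unimodular_oproiu_connection_def)
  have "\<forall>q\<in>U. J a q \<in> Q q" using Q by (simp add: span_base)
  \<comment> \<open>As \<open>J a\<close> is a section of \<open>Q\<close>, its derivative along
    \<open>X\<close> at \<open>p\<close> is a combination of the three structures, with coefficients
    that do not depend on the field \<open>Z\<close> it is applied to.\<close>
  then obtain R where R: "R p \<in> Q p" "\<And>Z. Z \<in> vector_fields \<A> U \<Longrightarrow> cov_endo D X (J a) Z p = R p (Z p)"
    using pres U X admissible_basis_smooth[OF J mem(1)] p
    unfolding preserves_bundle_def app_field_apply by metis
  obtain r s t where rst: "R p = r *\<^sub>R J a p + s *\<^sub>R J b p + t *\<^sub>R J c p"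
    using in_span_three R(1) Q[OF p] by metis
  have JZ: "app_field (J a) Z \<in> vector_fields \<A> U" if "Z \<in> vector_fields \<A> U" for Z
    by (rule admissible_basis_app_field[OF J mem(1) that])
  have DJ: "D X (app_field (J a) Z) p = J a p (D X Z p) + (r *\<^sub>R J a p (Z p) + s *\<^sub>R J b p (Z p) + t *\<^sub>R J c p (Z p))"
    if "Z \<in> vector_fields \<A> U" for Z
    using R(2)[OF that] by (simp add: cov_endo_def app_field_apply rst blinfun.bilinear_simps algebra_simps)
  \<comment> \<open>Differentiating \<open>J a\<close> twice applied to \<open>Z\<close>, which is
    \<open>- Z\<close>, shows that the derivative of \<open>J a\<close> anticommutes with
    \<open>J a\<close>; hence it has no component along \<open>J a\<close>.\<close>
  have r0: "r *\<^sub>R Z p = 0" if Z: "Z \<in> vector_fields \<A> U" for Z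
  proof -
    let ?JJZ = "app_field (J a) (app_field (J a) Z)" and ?mZ = "\<lambda>q. (-1) *\<^sub>R Z q"
    have "?JJZ q = ?mZ q" if "q \<in> U" for q
      using quaternionic_triple.II[OF admissible_basis_triple[OF J that abc]] by (simp add: app_field_apply)
    then have "D X ?JJZ p = D X ?mZ p"
      by (rule affine_connection_cong[OF conn U X JZ[OF JZ[OF Z]] p vector_fields_uminus[OF U Z]])
    also have "D X ?mZ p = dir_deriv \<A> X (\<lambda>q. -1) p *\<^sub>R Z p + (-1) *\<^sub>R D X Z p"
      by (rule affine_connection_Leibniz[OF conn U X Z p const_smooth_function[OF U]])
    finally have "D X ?JJZ p = - D X Z p" by (simp add: dir_deriv_const)
    moreover have "D X ?JJZ p = - D X Z p - (r *\<^sub>R Z p + r *\<^sub>R Z p)"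
      by (simp add: DJ[OF JZ[OF Z]] DJ[OF Z] lin_simps app_field_apply algebra_simps)
    ultimately show ?thesis by (simp flip: scaleR_2)
  qed
  have DJ': "D X (app_field (J a) Z) p = J a p (D X Z p) + (s *\<^sub>R J b p (Z p) + t *\<^sub>R J c p (Z p))"
    if Z: "Z \<in> vector_fields \<A> U" for Z
  proof -
    have "r *\<^sub>R J a p (Z p) = 0" using r0[OF Z] by (metis blinfun.scaleR_right blinfun.zero_right)
    then show ?thesis by (simp add: DJ[OF Z])
  qed
  have form: "nondegenerate_two_form M \<A> \<omega>" using qsH by (simp add: almost_qsH_def)
  note form_p = form[unfolded nondegenerate_two_form_def, THEN conjunct1, THEN bspec, OF pM]
  have bil: "bilinear (\<omega> p)" using form_p by blast
  have nd: "u = 0" if "\<And>v. \<omega> p u v = 0" for u using form_p that by blast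
  have herm: "\<omega> q (J k q u) (J k q v) = \<omega> q u v" if "q \<in> U" "k \<in> {1,2,3}" for q k u v
    using qsH[unfolded almost_qsH_def, THEN conjunct2, THEN conjunct2] J that by blast
  note bs = bilinear_ladd[OF bil] bilinear_radd[OF bil] bilinear_lmul[OF bil] bilinear_rmul[OF bil]
    bilinear_lneg[OF bil] bilinear_rneg[OF bil] bilinear_lsub[OF bil] bilinear_rsub[OF bil]
  \<comment> \<open>Each identity comes from invariance of \<omega> under one structure. The
    opposite signs make the \<open>s\<close> and \<open>t\<close> terms of \<open>DJ'\<close> cancel
    when \<omega> is differentiated.\<close>
  have h: "\<omega> p (J b p u) (J a p v) = - \<omega> p (J c p u) v" "\<omega> p (J a p u) (J b p v) = \<omega> p (J c p u) v"
    "\<omega> p (J c p u) (J a p v) = \<omega> p (J b p u) v" "\<omega> p (J a p u) (J c p v) = - \<omega> p (J b p u) v" for u v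
    using herm[OF p mem(1), of "J b p u" "J a p v"] herm[OF p mem(2), of "J a p u" "J b p v"]
      herm[OF p mem(1), of "J c p u" "J a p v"] herm[OF p mem(3), of "J a p u" "J c p v"]
    by (simp_all add: bs)
  have "\<omega> p (A p (X p) (J a p (Y p))) (J a p (Z p)) = \<omega> p (J a p (A p (X p) (Y p))) (J a p (Z p))"
    if Z: "Z \<in> vector_fields \<A> U" for Z
  proof -
    have sf: "(\<lambda>q. \<omega> q (Y q) (Z q)) \<in> smooth_functions \<A> U"
      using form[unfolded nondegenerate_two_form_def, THEN conjunct2] U Y Z by blast
    have "dir_deriv \<A> X (\<lambda>q. \<omega> q (app_field (J a) Y q) (app_field (J a) Z q)) p =
        dir_deriv \<A> X (\<lambda>q. \<omega> q (Y q) (Z q)) p"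
      by (rule dir_deriv_cong[OF U p sf, symmetric]) (simp add: app_field_apply herm[OF _ mem(1)])
    then have "cov_two_form \<A> D X \<omega> (app_field (J a) Y) (app_field (J a) Z) p = cov_two_form \<A> D X \<omega> Y Z p"
      by (simp add: cov_two_form_def DJ'[OF Y] DJ'[OF Z] app_field_apply bs h herm[OF p mem(1)])
    moreover have "\<omega> p (A p (X p) (app_field (J a) Y p)) (app_field (J a) Z p) =
        1/2 * cov_two_form \<A> D X \<omega> (app_field (J a) Y) (app_field (J a) Z) p"
      using A U X JZ[OF Y] JZ[OF Z] p unfolding omega_correction_def by blast
    moreover have "\<omega> p (A p (X p) (Y p)) (Z p) = 1/2 * cov_two_form \<A> D X \<omega> Y Z p"
      using A U X Y Z p unfolding omega_correction_def by blast
    ultimately show ?thesis by (simp add: app_field_apply herm[OF p mem(1)])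
  qed
  note eq = this
  have "\<omega> p (A p (X p) (J a p (Y p)) - J a p (A p (X p) (Y p))) v = 0" for v
  proof -
    \<comment> \<open>With this value \<open>J a p (Z p)\<close> equals \<open>v\<close>, so
      \<open>eq\<close> tests against an arbitrary vector and nondegeneracy applies.\<close>
    obtain Z where "Z \<in> vector_fields \<A> U" "Z p = - J a p v" by (rule vector_field_at[OF U p])
    from eq[OF this(1)] this(2) show ?thesis by (simp add: bs lin_simps)
  qed
  then show ?thesis using nd by (metis right_minus_eq)
qed

text \<open>The torsions differ by A(X,Y) - A(Y,X). Once \<open>J a\<close> is moved out of the
  second argument of \<open>A\<close>, the eight terms of its projection cancel in pairs.\<close>

lemma proj_acs_torsion:
  assumes qsH: "almost_qsH M \<A> Q \<omega>" and D: "unimodular_oproiu_connection M \<A> n Q \<omega> D"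
    and A: "omega_correction M \<A> \<omega> D A"
    and J: "admissible_basis M \<A> Q U J" and p: "p \<in> U" and abc: "(a, b, c) \<in> cyclic_triples"
    and X: "X \<in> vector_fields \<A> U" and Y: "Y \<in> vector_fields \<A> U"
  shows "proj_acs (J a) (torsion \<A> (add_tensor D A)) X Y p = proj_acs (J a) (torsion \<A> D) X Y p"
proof -
  interpret quaternionic_triple "J a p" "J b p" "J c p"
    by (rule admissible_basis_triple[OF J p abc])
  have a: "a \<in> {1,2,3}" using cyclic_triples_set[OF abc] by auto
  note com = omega_correction_commutes[OF qsH D A J p abc]
  note app = admissible_basis_app_field[OF J a]
  show ?thesis
    using com[OF X Y] com[OF app[OF X] Y] com[OF Y X] com[OF app[OF Y] X]
    by (simp add: proj_acs_def torsion_def add_tensor_def app_field_apply lin_simps algebra_simps)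
qed

text \<open>Each bracket is written as \<open>D X Y - D Y X\<close> minus the torsion. The torsion
  terms form 4 \<pi>, the plain derivatives cancel, and the derivatives of \<open>J a\<close>
  contribute the terms with \<gamma>.\<close>

lemma nijenhuis_eq_proj_acs_torsion:
  assumes D: "connection_forms M \<A> U D J \<gamma>"
    and J: "admissible_basis M \<A> Q U J" and p: "p \<in> U" and abc: "(a, b, c) \<in> cyclic_triples"
    and X: "X \<in> vector_fields \<A> U" and Y: "Y \<in> vector_fields \<A> U"
  shows "nijenhuis \<A> (J a) X Y p = 4 *\<^sub>R proj_acs (J a) (torsion \<A> D) X Y p
    + quaternionic_triple.antisym_form (J a p) (J b p) (J c p)
        (\<lambda>u. \<gamma> c p (J a p u) - \<gamma> b p u) (X p) (Y p)"
proof -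
  interpret quaternionic_triple "J a p" "J b p" "J c p"
    by (rule admissible_basis_triple[OF J p abc])
  have mem: "a \<in> {1,2,3}" "b \<in> {1,2,3}" "c \<in> {1,2,3}" using cyclic_triples_set[OF abc] by auto
  note U = admissible_basis_open[OF J]
  have lin: "linear (\<gamma> b p)" "linear (\<gamma> c p)"
    using D mem p unfolding connection_forms_def one_form_def by blast+
  have DJ: "D X (app_field (J a) Y) p = J a p (D X Y p) + (\<gamma> c p (X p) *\<^sub>R J b p (Y p) - \<gamma> b p (X p) *\<^sub>R J c p (Y p))"
    if "X \<in> vector_fields \<A> U" "Y \<in> vector_fields \<A> U" for X Y
  proof -
    have "cov_endo D X (J a) Y p = \<gamma> c p (X p) *\<^sub>R J b p (Y p) - \<gamma> b p (X p) *\<^sub>R J c p (Y p)"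
      using D[unfolded connection_forms_def, THEN conjunct2, THEN bspec, OF abc, unfolded prod.case,
          THEN spec, THEN mp, OF conjI[OF U subset_refl]] that p by blast
    then show ?thesis by (simp add: cov_endo_def app_field_apply algebra_simps)
  qed
  note app = admissible_basis_app_field[OF J mem(1)]
  show ?thesis
    by (simp add: nijenhuis_def proj_acs_def torsion_def antisym_form_def app_field_apply
        DJ[OF X Y] DJ[OF Y X] DJ[OF app[OF X] Y] DJ[OF app[OF Y] X] lin_simps
        linear_neg[OF lin(1)] linear_neg[OF lin(2)] algebra_simps)
qed

end

section \<open>The integrability criterion\<close>

theorem corollary1p10:
  fixes M :: "'m topology"
    and \<A> :: "('m, 'e::euclidean_space) atlas"
    and Q :: "'m \<Rightarrow> ('e \<Rightarrow>\<^sub>L 'e) set"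
    and \<omega> :: "'m \<Rightarrow> 'e \<Rightarrow> 'e \<Rightarrow> real"
    and D :: "('m, 'e) field_op"
    and U :: "'m set"
    and J :: "nat \<Rightarrow> ('m, 'e) endo_field"
    and \<gamma> :: "nat \<Rightarrow> 'm \<Rightarrow> 'e \<Rightarrow> real"
    and \<psi> :: "'m \<Rightarrow> 'e \<Rightarrow> real"
    and n a b c :: nat
  assumes "smooth_manifold M \<A>"
    and "DIM('e) = 4 * n" and "n > 1"
    and "almost_qsH M \<A> Q \<omega>"
    and "adapted_connection M \<A> n Q \<omega> D"
    and "admissible_basis M \<A> Q U J"
    and "connection_forms M \<A> U D J \<gamma>"
    and "(a, b, c) \<in> cyclic_triples"
    and "\<psi> = (\<lambda>p u. \<gamma> c p (J a p u) - \<gamma> b p u)"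
  shows "integrable_acs M \<A> U (J a) \<longleftrightarrow>
    (\<forall>X \<in> vector_fields \<A> (topspace M). \<forall>Y \<in> vector_fields \<A> (topspace M). \<forall>p\<in>U.
       proj_acs (J a) (torsion \<A> D) X Y p = 0 \<and>
       \<psi> p (X p) *\<^sub>R J b p (Y p) + \<psi> p (J a p (X p)) *\<^sub>R J c p (Y p)
       - \<psi> p (Y p) *\<^sub>R J b p (X p) - \<psi> p (J a p (Y p)) *\<^sub>R J c p (X p) = 0)"
    (is "_ \<longleftrightarrow> (\<forall>X \<in> _. \<forall>Y \<in> _. \<forall>p\<in>U. ?P X Y p)")
proof -
  interpret manifold M \<A> by unfold_locales (rule assms(1))
  note J = assms(6) and abc = assms(8)
  note U = admissible_basis_open[OF J]
  have mem: "a \<in> {1,2,3}" "b \<in> {1,2,3}" "c \<in> {1,2,3}" using cyclic_triples_set[OF abc] by auto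
  note app = admissible_basis_app_field[OF J mem(1)]
  obtain D0 A where D0: "unimodular_oproiu_connection M \<A> n Q \<omega> D0"
    and A: "omega_correction M \<A> \<omega> D0 A" and D: "D = add_tensor D0 A"
    using assms(5) unfolding adapted_connection_def by blast
  have nij: "nijenhuis \<A> (J a) X Y p = 4 *\<^sub>R proj_acs (J a) (torsion \<A> D) X Y p
      + quaternionic_triple.antisym_form (J a p) (J b p) (J c p) (\<psi> p) (X p) (Y p)"
    if "p \<in> U" "X \<in> vector_fields \<A> U" "Y \<in> vector_fields \<A> U" for X Y p
    using nijenhuis_eq_proj_acs_torsion[OF assms(7) J that(1) abc that(2,3)] by (simp add: assms(9))
  show ?thesis
  proof
    assume int: "integrable_acs M \<A> U (J a)"
    have "?P X Y p" if X: "X \<in> vector_fields \<A> (topspace M)" and Y: "Y \<in> vector_fields \<A> (topspace M)"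
      and p: "p \<in> U" for X Y p
    proof -
      interpret quaternionic_triple "J a p" "J b p" "J c p"
        by (rule admissible_basis_triple[OF J p abc])
      obtain B where B: "bilinear B"
        "\<And>X Y. X \<in> vector_fields \<A> U \<Longrightarrow> Y \<in> vector_fields \<A> U \<Longrightarrow>
          torsion \<A> D0 X Y p = normalised (4 * real n - 2) B (X p) (Y p)"
        by (rule unimodular_oproiu_torsion[OF D0 J p abc]) blast
      \<comment> \<open>The projection is unchanged on passing from \<open>D\<close> to
        \<open>D0\<close>, whose torsion has the normalised form needed for the trace
        argument.\<close>
      have proj: "4 *\<^sub>R proj_acs (J a) (torsion \<A> D) X Y p = proj4 (normalised (4 * real n - 2) B) (X p) (Y p)"
        if "X \<in> vector_fields \<A> U" "Y \<in> vector_fields \<A> U" for X Y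
        unfolding D proj_acs_torsion[OF assms(4) D0 A J p abc that]
        using B(2) that app by (simp add: proj_acs_def proj4_def app_field_apply)
      have lin: "linear (\<psi> p)"
      proof -
        have "linear (\<gamma> b p)" "linear (\<gamma> c p)"
          using assms(7) mem p unfolding connection_forms_def one_form_def by blast+
        then show ?thesis
          unfolding assms(9) using linear_compose[OF linI, of "\<gamma> c p"]
          by (intro linear_compose_sub) (simp_all add: o_def)
      qed
      have \<psi>: "\<psi> p u = 0" for u
      proof (rule form_eq_0[OF B(1) _ _ lin])
        show "4 * real n - 2 = real DIM('e) - 2" using assms(2) by simp
        show "4 * real n - 2 \<noteq> 0" using assms(3) by linarith
        \<comment> \<open>Any \<open>u\<close> and \<open>v\<close> are values at \<open>p\<close>
          of fields on \<open>U\<close>, so the vanishing of the Nijenhuis tensor is an identity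
          between bilinear maps on the tangent space.\<close>
        show "proj4 (normalised (4 * real n - 2) B) u v + antisym_form (\<psi> p) u v = 0" for u v
        proof -
          obtain X Y where XY: "X \<in> vector_fields \<A> U" "X p = u" "Y \<in> vector_fields \<A> U" "Y p = v"
            using vector_field_at[OF U p] by metis
          have "nijenhuis \<A> (J a) X Y p = 0"
            using int U p XY unfolding integrable_acs_def by blast
          then show ?thesis using nij[OF p XY(1,3)] proj[OF XY(1,3)] XY by simp
        qed
      qed
      have XY: "X \<in> vector_fields \<A> U" "Y \<in> vector_fields \<A> U"
        using X Y vector_fields_mono openin_subset[OF U] by blast+
      have "nijenhuis \<A> (J a) X Y p = 0"
        using int U p XY unfolding integrable_acs_def by blast
      then have "proj_acs (J a) (torsion \<A> D) X Y p = 0"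
        using nij[OF p XY] \<psi> by (simp add: antisym_form_def)
      then show ?thesis using \<psi> by simp
    qed
    then show "\<forall>X \<in> vector_fields \<A> (topspace M). \<forall>Y \<in> vector_fields \<A> (topspace M). \<forall>p\<in>U. ?P X Y p"
      by blast
  next
    assume R: "\<forall>X \<in> vector_fields \<A> (topspace M). \<forall>Y \<in> vector_fields \<A> (topspace M). \<forall>p\<in>U. ?P X Y p"
    show "integrable_acs M \<A> U (J a)"
      unfolding integrable_acs_def
    proof (intro allI impI ballI)
      fix V X Y p
      assume V: "openin M V \<and> V \<subseteq> U" and X: "X \<in> vector_fields \<A> V"
        and Y: "Y \<in> vector_fields \<A> V" and pV: "p \<in> V"
      have p: "p \<in> U" using V pV by blast
      interpret quaternionic_triple "J a p" "J b p" "J c p"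
        by (rule admissible_basis_triple[OF J p abc])
      \<comment> \<open>The Nijenhuis tensor at \<open>p\<close> depends only on the values there.
        Hence \<open>X\<close> and \<open>Y\<close>, defined on \<open>V\<close> alone, may be
        replaced by the global fields \<open>X'\<close> and \<open>Y'\<close> with the same values
        at \<open>p\<close>.\<close>
      obtain B where B: "\<And>V X Y. openin M V \<Longrightarrow> p \<in> V \<Longrightarrow> X \<in> vector_fields \<A> V \<Longrightarrow>
          Y \<in> vector_fields \<A> V \<Longrightarrow> nijenhuis \<A> (J a) X Y p = B (X p) (Y p)"
        by (rule nijenhuis_tensor[OF U admissible_basis_smooth[OF J mem(1)] p II]) blast
      obtain X' where X': "X' \<in> vector_fields \<A> (topspace M)" "X' \<in> vector_fields \<A> U" "X' p = X p"
        by (rule vector_field_at[OF U p])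
      obtain Y' where Y': "Y' \<in> vector_fields \<A> (topspace M)" "Y' \<in> vector_fields \<A> U" "Y' p = Y p"
        by (rule vector_field_at[OF U p])
      have "?P X' Y' p" using R X'(1) Y'(1) p by blast
      then have "nijenhuis \<A> (J a) X' Y' p = 0"
        using nij[OF p X'(2) Y'(2)] by (simp add: antisym_form_def)
      then show "nijenhuis \<A> (J a) X Y p = 0"
        using B[OF U p X'(2) Y'(2)] B[OF _ pV X Y] V X'(3) Y'(3) by simp
    qed
  qed
qed

end
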